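(* Consider the two-dimensional ($xy$-edge) PML equation in Laplace space on $\Omega=[-1,1]^3$, $$(sS_x)\,\mathbf P^{-1}\widetilde{\mathbf Q}=\sum_{\xi=x,y}\mathbf A_\xi\frac{\partial\widetilde{\mathbf Q}}{\partial\xi}+\mathbf P^{-1}\widetilde{\mathbf F},\qquad \widetilde{\mathbf F}=\mathbf P\Big(S_x\widetilde{\mathbf F}_Q-\sum_{\xi=x,y}\frac{d}{s+\alpha}\widetilde{\mathbf F}_{w_\xi}\Big),$$ with piecewise constant $d_x(x)=d_y(y)=d\ge0$ and $\alpha_x=\alpha_y=\alpha\ge0$, where $S_x=S_y=1+\frac{d}{s+\alpha}$, subject to the boundary conditions, for $\xi\in\{x,y\}$ and $\eta=x,y,z$, $$\tfrac{Z_\eta}{2}(1-\gamma_\eta)\widetilde v_\eta-\tfrac{1+\gamma_\eta}{2}\widetilde T_\eta=0\ \text{ at } \xi=-1,\qquad \tfrac{Z_\eta}{2}(1-\gamma_\eta)\widetilde v_\eta+\tfrac{1+\gamma_\eta}{2}\widetilde T_\eta=0\ \text{ at } \xi=1,$$ with real $|\gamma_\eta|\le1$, and to the interface conditions $\widetilde{\mathbf T}^+=\widetilde{\mathbf T}^-$, $\widetilde{\mathbf v}^+-\widetilde{\mathbf v}^-=0$ at discontinuities of $d_x(x)$, $d_y(y)$. Then for all $s\in\mathbb C$ with $\Re(s)\ge a>0$ we have $\Re(sS_x)\ge a>0$ and $$\big\|\sqrt{\Re(sS_x)}\,\widetilde{\mathbf Q}(\cdot,\cdot,\cdot,s)\big\|_P^2\le\|\widetilde{\mathbf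 Q}(\cdot,\cdot,\cdot,s)\|_P\,\|\widetilde{\mathbf F}(\cdot,\cdot,\cdot,s)\|_P+\widetilde{\mathrm{BT}},$$ where $$\widetilde{\mathrm{BT}}=\sum_{\xi=x,y}\int_{[-1,1]^2}\tfrac12\Big[\widetilde{\mathbf Q}^\dagger\mathbf A_\xi\widetilde{\mathbf Q}\Big]\Big|_{\xi=-1}^{\xi=1}\,\frac{dx\,dy\,dz}{d\xi}\le0 .$$
   Context: The unknown is $\widetilde{\mathbf Q}=(\widetilde{\mathbf v},\widetilde{\boldsymbol\sigma})$ with values in $\mathbb C^9$: velocity $\widetilde{\mathbf v}=(\widetilde v_x,\widetilde v_y,\widetilde v_z)$ and stress $\widetilde{\boldsymbol\sigma}=(\sigma_{xx},\sigma_{yy},\sigma_{zz},\sigma_{xy},\sigma_{xz},\sigma_{yz})$. It is the Laplace transform in time (dual variable $s$) of the solution of the perfectly matched layer (PML) system for linear elastodynamics with zero initial data. In the $xy$-edge problem $d_z=0$, and data and solution do not depend on $z$ (but live on the 3D domain $\Omega$). "Piecewise constant" means that $\Omega$ is split by finitely many planes $x=\text{const}$, $y=\text{const}$ into boxes on each of which the common damping value $d$ is constant. Solutions are understood to be sufficiently regular (e.g. $H^1$) on each box, satisfying the equation there. $\widetilde{\mathbf F}_Q,\widetilde{\mathbf F}_{w_\xi}$ are given (Laplace-transformed) source terms in $L^2(\Omega)$. $\mathbf A_\xi=\begin{pmatrix}\mathbf 0_3&\mathbf a_\xi\\ \mathbf a_\xi^T&\mathbf 0_6\end{pmatrix}$,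 $\mathbf a_x=\begin{pmatrix}1&0&0&0&0&0\\0&0&0&1&0&0\\0&0&0&0&1&0\end{pmatrix}$, $\mathbf a_y=\begin{pmatrix}0&0&0&1&0&0\\0&1&0&0&0&0\\0&0&0&0&0&1\end{pmatrix}$. $\mathbf P=\mathrm{diag}(\rho^{-1}\mathbf 1_3,\mathbf C)$ is symmetric positive definite and may depend on position, with density $\rho>0$ and symmetric positive definite elastic stiffness matrix $\mathbf C\in\mathbb R^{6\times6}$. The traction on planes $\xi=\text{const}$ is $\widetilde{\mathbf T}=\mathbf a_\xi\widetilde{\boldsymbol\sigma}$, with components $\widetilde T_\eta$, $\eta=x,y,z$. The impedances on such planes are $Z_\eta=\rho c_\eta>0$, with $c_\eta=c_p$ if $\eta=\xi$ and $c_\eta=c_s$ if $\eta\neq\xi$ (P- and S-wave speeds; in the isotropic case with Lamé parameters $\lambda,\mu$: $c_p=\sqrt{(2\mu+\lambda)/\rho}$, $c_s=\sqrt{\mu/\rho}$). Superscripts $\pm$ denote the one-sided limits on the two sides of an interface, and $\dagger$ is the complex conjugate transpose. The notation $\frac{dx\,dy\,dz}{d\xi}$ means integration over the two coordinates other than $\xi$. The weighted inner product and norm are $(\mathbf Q,\mathbf F)_P=\int_\Omega\frac12\mathbf Q^\dagger\mathbf P^{-1}\mathbf F\,dx\,dy\,dz$ and $\|\mathbf Q\|_P^2=(\mathbf Q,\mathbf Q)_P$.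
   Formalization: The inequality is proved with BT/2 in place of BT: since the P-inner product already carries a factor 1/2, the printed version with BT fails (e.g. d=0, γ=1/3 and F a positive multiple of Q); BT itself is as displayed, and BT ≤ 0 is proved. ‖F‖_P is assumed finite. *)

theory Defs
  imports "HOL-Analysis.Analysis"
begin

(* Points are triples (x, y, z).  Directions and vector components are indexed by the
   numeral type 3 with 1 = x, 2 = y, 3 = z; stress components by 6 in the order
   xx, yy, zz, xy, xz, yz.  A field value is a vector over the sum type 3 + 6,
   Inl indexing the velocity and Inr the stress. *)

type_synonym pos = "real \<times> real \<times> real"
type_synonym state = "complex ^ (3 + 6)"

definition vel :: "state \<Rightarrow> complex ^ 3" where
  "vel w = (\<chi> i. w $ Inl i)"

definition stress :: "state \<Rightarrow> complex ^ 6" where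
  "stress w = (\<chi> i. w $ Inr i)"

definition hdot :: "complex ^ 'n \<Rightarrow> complex ^ 'n \<Rightarrow> complex" where
  "hdot u w = (\<Sum>i\<in>UNIV. cnj (u $ i) * w $ i)"

definition cmat :: "real ^ 'm ^ 'n \<Rightarrow> complex ^ 'm ^ 'n" where
  "cmat M = map_matrix complex_of_real M"

definition amat :: "3 \<Rightarrow> real ^ 6 ^ 3" where
  "amat \<xi> =
    (if \<xi> = 1 then
       vector [vector [1, 0, 0, 0, 0, 0],
               vector [0, 0, 0, 1, 0, 0],
               vector [0, 0, 0, 0, 1, 0]]
     else if \<xi> = 2 then
       vector [vector [0, 0, 0, 1, 0, 0],
               vector [0, 1, 0, 0, 0, 0],
               vector [0, 0, 0, 0, 0, 1]]
     else
       vector [vector [0, 0, 0, 0, 1, 0],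
               vector [0, 0, 0, 0, 0, 1],
               vector [0, 0, 1, 0, 0, 0]])"

definition Amat :: "3 \<Rightarrow> real ^ (3 + 6) ^ (3 + 6)" where
  "Amat \<xi> = (\<chi> k l. case (k, l) of
      (Inl i, Inr j) \<Rightarrow> amat \<xi> $ i $ j
    | (Inr j, Inl i) \<Rightarrow> amat \<xi> $ i $ j
    | _ \<Rightarrow> 0)"

definition Pmat :: "real \<Rightarrow> real ^ 6 ^ 6 \<Rightarrow> real ^ (3 + 6) ^ (3 + 6)" where
  "Pmat \<rho> C = (\<chi> k l. case (k, l) of
      (Inl i, Inl j) \<Rightarrow> (if i = j then inverse \<rho> else 0)
    | (Inr i, Inr j) \<Rightarrow> C $ i $ j
    | _ \<Rightarrow> 0)"

definition sym_pos_def :: "real ^ 'n ^ 'n \<Rightarrow> bool" where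
  "sym_pos_def M \<longleftrightarrow> transpose M = M \<and> (\<forall>v. v \<noteq> 0 \<longrightarrow> v \<bullet> (M *v v) > 0)"

definition traction :: "3 \<Rightarrow> state \<Rightarrow> complex ^ 3" where
  "traction \<xi> w = cmat (amat \<xi>) *v stress w"

definition impedance ::
  "(pos \<Rightarrow> real) \<Rightarrow> (pos \<Rightarrow> real) \<Rightarrow> (pos \<Rightarrow> real) \<Rightarrow> 3 \<Rightarrow> 3 \<Rightarrow> pos \<Rightarrow> real" where
  "impedance \<rho> cp cs \<xi> \<eta> p = \<rho> p * (if \<eta> = \<xi> then cp p else cs p)"

definition Omega :: "pos set" where
  "Omega = cbox (-1, -1, -1) (1, 1, 1)"

definition Face :: "(real \<times> real) set" where
  "Face = cbox (-1, -1) (1, 1)"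

(* The point with \<xi>-coordinate t whose two other coordinates are q, in their natural order. *)
definition pt :: "3 \<Rightarrow> real \<Rightarrow> real \<times> real \<Rightarrow> pos" where
  "pt \<xi> t q = (if \<xi> = 1 then (t, fst q, snd q)
              else if \<xi> = 2 then (fst q, t, snd q)
              else (fst q, snd q, t))"

definition grid :: "nat \<Rightarrow> (nat \<Rightarrow> real) \<Rightarrow> bool" where
  "grid n g \<longleftrightarrow> g 0 = -1 \<and> g n = 1 \<and> (\<forall>i<n. g i < g (Suc i))"

definition Cell :: "(3 \<Rightarrow> nat \<Rightarrow> real) \<Rightarrow> nat \<Rightarrow> nat \<Rightarrow> pos set" where
  "Cell g i j = box (g 1 i, g 2 j, -1) (g 1 (Suc i), g 2 (Suc j), 1)"

definition z_indep :: "(pos \<Rightarrow> 'a) \<Rightarrow> bool" where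
  "z_indep u \<longleftrightarrow>
     (\<forall>x y z z'. (x, y, z) \<in> Omega \<longrightarrow> (x, y, z') \<in> Omega \<longrightarrow> u (x, y, z) = u (x, y, z'))"

definition L2_on :: "pos set \<Rightarrow> (pos \<Rightarrow> state) \<Rightarrow> bool" where
  "L2_on B u \<longleftrightarrow> set_borel_measurable lebesgue B u \<and> set_integrable lebesgue B (\<lambda>p. (norm (u p))\<^sup>2)"

(* On almost every line in direction \<xi>, u is absolutely continuous inside B with derivative w
   (expressed as u being an indefinite Lebesgue integral of w). *)
definition acl_partial :: "3 \<Rightarrow> pos set \<Rightarrow> (pos \<Rightarrow> state) \<Rightarrow> (pos \<Rightarrow> state) \<Rightarrow> bool" where
  "acl_partial \<xi> B u w \<longleftrightarrow>
     (AE q in lebesgue. \<forall>r t. r \<le> t \<and> (\<forall>\<tau>\<in>{r..t}. pt \<xi> \<tau> q \<in> B) \<longrightarrow>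
        set_integrable lebesgue {r..t} (\<lambda>\<tau>. w (pt \<xi> \<tau> q)) \<and>
        u (pt \<xi> t q) - u (pt \<xi> r q) = (LINT \<tau>:{r..t}|lebesgue. w (pt \<xi> \<tau> q)))"

(* The Sobolev space H^1(B), B open, with D \<xi> the partial derivatives, in the Beppo Levi
   form: u is the representative that is absolutely continuous on almost all coordinate
   lines.  For a box B the one-sided limits of u at the faces then exist along almost all
   lines, and they are the traces of u. *)
definition H1_on :: "pos set \<Rightarrow> (pos \<Rightarrow> state) \<Rightarrow> (3 \<Rightarrow> pos \<Rightarrow> state) \<Rightarrow> bool" where
  "H1_on B u D \<longleftrightarrow> L2_on B u \<and> (\<forall>\<xi>. L2_on B (D \<xi>) \<and> acl_partial \<xi> B u (D \<xi>))"

definition trace_plus :: "3 \<Rightarrow> real \<Rightarrow> (pos \<Rightarrow> state) \<Rightarrow> real \<times> real \<Rightarrow> state" where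
  "trace_plus \<xi> t u q = Lim (at_right t) (\<lambda>r. u (pt \<xi> r q))"

definition trace_minus :: "3 \<Rightarrow> real \<Rightarrow> (pos \<Rightarrow> state) \<Rightarrow> real \<times> real \<Rightarrow> state" where
  "trace_minus \<xi> t u q = Lim (at_left t) (\<lambda>r. u (pt \<xi> r q))"

definition inner_P :: "(pos \<Rightarrow> real ^ (3 + 6) ^ (3 + 6)) \<Rightarrow> (pos \<Rightarrow> state) \<Rightarrow> (pos \<Rightarrow> state) \<Rightarrow> complex"
  where
  "inner_P P u w =
     (LINT p:Omega|lebesgue. (1/2) * hdot (u p) (cmat (matrix_inv (P p)) *v w p))"

definition norm_P :: "(pos \<Rightarrow> real ^ (3 + 6) ^ (3 + 6)) \<Rightarrow> (pos \<Rightarrow> state) \<Rightarrow> real" where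
  "norm_P P u = sqrt (Re (inner_P P u u))"

(* Without this condition the Bochner integral in norm_P would be 0 by convention. *)
definition finite_norm_P :: "(pos \<Rightarrow> real ^ (3 + 6) ^ (3 + 6)) \<Rightarrow> (pos \<Rightarrow> state) \<Rightarrow> bool" where
  "finite_norm_P P u \<longleftrightarrow>
     set_integrable lebesgue Omega (\<lambda>p. hdot (u p) (cmat (matrix_inv (P p)) *v u p))"

definition S_pml :: "(pos \<Rightarrow> real) \<Rightarrow> real \<Rightarrow> complex \<Rightarrow> pos \<Rightarrow> complex" where
  "S_pml d \<alpha> s p = 1 + of_real (d p) / (s + of_real \<alpha>)"

definition source ::
  "(pos \<Rightarrow> real ^ (3 + 6) ^ (3 + 6)) \<Rightarrow> (pos \<Rightarrow> real) \<Rightarrow> real \<Rightarrow> complex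
     \<Rightarrow> (pos \<Rightarrow> state) \<Rightarrow> (3 \<Rightarrow> pos \<Rightarrow> state) \<Rightarrow> pos \<Rightarrow> state" where
  "source P d \<alpha> s FQ Fw p = cmat (P p) *v
     (S_pml d \<alpha> s p *s FQ p - (\<Sum>\<xi>\<in>{1, 2}. (of_real (d p) / (s + of_real \<alpha>)) *s Fw \<xi> p))"

definition pml_equation_on ::
  "pos set \<Rightarrow> (pos \<Rightarrow> real ^ (3 + 6) ^ (3 + 6)) \<Rightarrow> (pos \<Rightarrow> real) \<Rightarrow> real \<Rightarrow> complex
     \<Rightarrow> (pos \<Rightarrow> state) \<Rightarrow> (3 \<Rightarrow> pos \<Rightarrow> state) \<Rightarrow> (pos \<Rightarrow> state) \<Rightarrow> bool" where
  "pml_equation_on B P d \<alpha> s Q DQ F \<longleftrightarrow>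
     (AE p in lebesgue. p \<in> B \<longrightarrow>
        (s * S_pml d \<alpha> s p) *s (cmat (matrix_inv (P p)) *v Q p) =
          (\<Sum>\<xi>\<in>{1, 2}. cmat (Amat \<xi>) *v DQ \<xi> p) + cmat (matrix_inv (P p)) *v F p)"

definition boundary_conditions ::
  "(3 \<Rightarrow> 3 \<Rightarrow> pos \<Rightarrow> real) \<Rightarrow> (3 \<Rightarrow> real) \<Rightarrow> (pos \<Rightarrow> state) \<Rightarrow> bool" where
  "boundary_conditions Z \<gamma> Q \<longleftrightarrow>
     (\<forall>\<xi>\<in>{1, 2}. \<forall>\<eta>. AE q in lebesgue. q \<in> Face \<longrightarrow>
        of_real (Z \<xi> \<eta> (pt \<xi> (-1) q) / 2 * (1 - \<gamma> \<eta>)) * vel (trace_plus \<xi> (-1) Q q) $ \<eta>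
          - of_real ((1 + \<gamma> \<eta>) / 2) * traction \<xi> (trace_plus \<xi> (-1) Q q) $ \<eta> = 0 \<and>
        of_real (Z \<xi> \<eta> (pt \<xi> 1 q) / 2 * (1 - \<gamma> \<eta>)) * vel (trace_minus \<xi> 1 Q q) $ \<eta>
          + of_real ((1 + \<gamma> \<eta>) / 2) * traction \<xi> (trace_minus \<xi> 1 Q q) $ \<eta> = 0)"

(* Imposed on every interior plane of the grid.  Where d does not jump across such a plane
   the conditions hold automatically for a solution that is H^1 across it. *)
definition interface_conditions ::
  "(3 \<Rightarrow> nat) \<Rightarrow> (3 \<Rightarrow> nat \<Rightarrow> real) \<Rightarrow> (pos \<Rightarrow> state) \<Rightarrow> bool" where
  "interface_conditions N g Q \<longleftrightarrow>
     (\<forall>\<xi>\<in>{1, 2}. \<forall>i\<in>{1..<N \<xi>}. AE q in lebesgue. q \<in> Face \<longrightarrow>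
        traction \<xi> (trace_plus \<xi> (g \<xi> i) Q q) = traction \<xi> (trace_minus \<xi> (g \<xi> i) Q q) \<and>
        vel (trace_plus \<xi> (g \<xi> i) Q q) - vel (trace_minus \<xi> (g \<xi> i) Q q) = 0)"

(* Because inner_P carries a factor 1/2, integration by parts gives the energy identity
   2 Re(s S) |Q|_P^2 = 2 Re (Q, F)_P + BT (for constant S), so BT enters an estimate of
   |sqrt(Re(s S)) Q|_P^2 with the factor 1/2.  With the factor 1 the estimate is false:
   take d = 0, rho = mu = 1, gamma_z = 1/3 and a = -artanh (1/sqrt 2), lam = sqrt 2 * a < 0,
   v_z = cosh (a x) cosh (a y), sigma_xz = (d/dx v_z) / lam, sigma_yz = (d/dy v_z) / lam,
   s = 1, all else 0.  This solves the problem with F = (s - lam) Q, and BT = 2 lam |Q|_P^2. *)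
definition boundary_term :: "(pos \<Rightarrow> state) \<Rightarrow> complex" where
  "boundary_term Q =
     (\<Sum>\<xi>\<in>{1, 2}. LINT q:Face|lebesgue. (1/2) *
        (hdot (trace_minus \<xi> 1 Q q) (cmat (Amat \<xi>) *v trace_minus \<xi> 1 Q q)
         - hdot (trace_plus \<xi> (-1) Q q) (cmat (Amat \<xi>) *v trace_plus \<xi> (-1) Q q)))"

end

theory Submission
  imports Defs
begin

text \<open>
  The estimate is an energy balance. Testing the equation with $Q$ gives, almost everywhere,
  \[ \mathrm{Re}\,(s S)\, Q^\dagger P^{-1} Q =
     \sum_\xi \mathrm{Re}\,(Q^\dagger A_\xi \partial_\xi Q) + \mathrm{Re}\,(Q^\dagger P^{-1} F), \]
  because $Q^\dagger P^{-1} Q$ is real. Integrated over the cube with the factor $\frac12$, the left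
  side is the left side of the claim. The source term is bounded by Cauchy-Schwarz in the weighted
  inner product (\<open>norm_P_Cauchy_Schwarz\<close>).

  Since $A_\xi$ is symmetric, $2\,\mathrm{Re}\,(Q^\dagger A_\xi \partial_\xi Q)$ is the derivative of
  $Q^\dagger A_\xi Q = 2\,\mathrm{Re}\,(v^\dagger T)$ along lines in direction $\xi$. On almost every
  such line, $Q$ is piecewise absolutely continuous, the contributions of the cells telescope because
  velocity and traction are continuous across the grid planes (\<open>column_flux\<close>, \<open>line_flux\<close>), and
  Fubini's theorem turns the two outermost values into the boundary term (\<open>flux_integral\<close>). The
  fields are merely absolutely continuous on lines, so the chain rule is derived from integration by
  parts for primitives, which is Fubini on a triangle (\<open>primitive_bilinear_chain_rule\<close>).

  The boundary conditions make traction and velocity parallel, with the sign that lets energy only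
  leave (\<open>boundary_sign\<close>); hence the boundary term is nonpositive. The bound on $\mathrm{Re}\,(s S)$
  is elementary (\<open>Re_pml_stretch\<close>).

  Splitting the integrated balance into its terms requires each of them to be integrable, although
  the material parameters need not be bounded. This again comes from the equation: it writes
  $P^{-1} Q$ as a combination of square-integrable fields (\<open>cell_energy\<close>).
\<close>

section \<open>Fubini along coordinate lines\<close>

lemma continuous_pt: "continuous_on UNIV (\<lambda>(q, t). pt \<xi> t q)"
  unfolding pt_def case_prod_beta
  by (cases "\<xi> = 1"; cases "\<xi> = 2"; auto intro!: continuous_intros)

text \<open>
  Placing the line parameter at coordinate \<open>\<xi>\<close> only permutes coordinates, so it maps boxes to boxes
  of the same volume. This reduces Fubini in every coordinate direction to Fubini for a product.
\<close>
lemma pt_lborel: "distr lborel lborel (\<lambda>(q, t). pt \<xi> t q) = lborel"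
proof (rule lborel_eqI[symmetric])
  have mf: "(\<lambda>(q, t). pt \<xi> t q) \<in> borel_measurable borel"
    using continuous_pt by (rule borel_measurable_continuous_onI)
  show "emeasure (distr lborel lborel (\<lambda>(q, t). pt \<xi> t q)) (box l u) = ennreal (prod ((\<bullet>) (u - l)) Basis)"
    if lu: "\<And>b. b \<in> Basis \<Longrightarrow> l \<bullet> b \<le> u \<bullet> b" for l u :: pos
  proof -
    obtain l1 l2 l3 where l: "l = (l1, l2, l3)" by (cases l) auto
    obtain u1 u2 u3 where u: "u = (u1, u2, u3)" by (cases u) auto
    have le: "l1 \<le> u1" "l2 \<le> u2" "l3 \<le> u3"
      using lu[of "(1,0,0)"] lu[of "(0,1,0)"] lu[of "(0,0,1)"]
      by (auto simp: l u Basis_prod_def zero_prod_def)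
    let ?l = "if \<xi> = 1 then ((l2, l3), l1) else if \<xi> = 2 then ((l1, l3), l2) else ((l1, l2), l3)"
    let ?u = "if \<xi> = 1 then ((u2, u3), u1) else if \<xi> = 2 then ((u1, u3), u2) else ((u1, u2), u3)"
    have "(\<lambda>(q, t). pt \<xi> t q) -` box l u = box ?l ?u"
      by (cases "\<xi> = 1"; cases "\<xi> = 2")
        (auto simp: l u pt_def mem_box Basis_prod_def zero_prod_def)
    moreover have "emeasure lborel (box ?l ?u) = ennreal (prod ((\<bullet>) (?u - ?l)) Basis)"
      using le by (intro emeasure_lborel_box)
        (cases "\<xi> = 1"; cases "\<xi> = 2"; auto simp: Basis_prod_def)
    moreover have "prod ((\<bullet>) (?u - ?l)) Basis = prod ((\<bullet>) (u - l)) Basis"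
      by (cases "\<xi> = 1"; cases "\<xi> = 2")
        (simp_all add: l u Basis_prod_def prod.union_disjoint prod.reindex inj_on_def
          image_Un image_image)
    ultimately show ?thesis
      using mf by (simp add: emeasure_distr)
  qed
qed simp

text \<open>
  Lebesgue measure is not a product measure, only the completion of one. So $f$ is replaced by a
  Borel representative, to which Fubini's theorem applies; on almost every line the two agree
  almost everywhere. Measurability of the line integrals is part of the conclusion because they
  will be compared, almost everywhere, with boundary values whose measurability is not known.
\<close>
lemma lebesgue_Fubini_pt:
  fixes f :: "pos \<Rightarrow> real"
  assumes f: "integrable lebesgue f"
  shows "AE q in lebesgue. integrable lebesgue (\<lambda>t. f (pt \<xi> t q))"
    and "(\<lambda>q. LINT t|lebesgue. f (pt \<xi> t q)) \<in> borel_measurable lebesgue"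
    and "integral\<^sup>L lebesgue f = (LINT q|lebesgue. LINT t|lebesgue. f (pt \<xi> t q))"
proof -
  have mpt: "(\<lambda>(q, t). pt \<xi> t q) \<in> lborel \<rightarrow>\<^sub>M lborel"
    unfolding measurable_lborel1 measurable_lborel2
    using continuous_pt by (rule borel_measurable_continuous_onI)
  have mptt: "(\<lambda>t. pt \<xi> t q) \<in> borel_measurable borel" for q
    by (intro borel_measurable_continuous_onI continuous_on_compose2[OF continuous_pt, of UNIV "Pair q", simplified])
      (auto intro!: continuous_intros)
  obtain g where g: "g \<in> borel_measurable lborel" and fg: "AE p in lborel. f p = g p"
    using completion_ex_borel_measurable_real[of f lborel] f by auto
  have gL: "g \<in> borel_measurable lebesgue" using g by (rule measurable_completion)
  have g_int: "integrable lborel g"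
    using integrable_cong_AE_imp[OF f gL] AE_completion[OF fg] integrable_completion[OF g]
    by (auto elim: AE_mp)
  have "integrable (distr lborel lborel (\<lambda>(q, t). pt \<xi> t q)) g"
    unfolding pt_lborel using g_int .
  then have G: "integrable (lborel \<Otimes>\<^sub>M lborel) (\<lambda>(q, t). g (pt \<xi> t q))"
    using g mpt by (subst (asm) integrable_distr_eq) (auto simp: lborel_prod case_prod_beta')
  have "AE p in distr lborel lborel (\<lambda>(q, t). pt \<xi> t q). f p = g p"
    unfolding pt_lborel using fg .
  then have "AE x in lborel. case x of (q, t) \<Rightarrow> f (pt \<xi> t q) = g (pt \<xi> t q)"
    using AE_distrD[OF mpt] by (auto simp: case_prod_beta)
  then have "AE x in lborel \<Otimes>\<^sub>M lborel. case x of (q, t) \<Rightarrow> f (pt \<xi> t q) = g (pt \<xi> t q)"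
    unfolding lborel_prod .
  then have ae: "AE q in lborel. AE t in lborel. f (pt \<xi> t q) = g (pt \<xi> t q)"
    using lborel_pair.AE_pair by fastforce
  have gsec: "(\<lambda>t. g (pt \<xi> t q)) \<in> borel_measurable borel" for q
    using measurable_compose[OF mptt, of g borel] g by simp
  have line: "integrable lebesgue (\<lambda>t. f (pt \<xi> t q)) = integrable lborel (\<lambda>t. g (pt \<xi> t q))
      \<and> (LINT t|lebesgue. f (pt \<xi> t q)) = (LINT t|lborel. g (pt \<xi> t q))"
    if "AE t in lborel. f (pt \<xi> t q) = g (pt \<xi> t q)" for q
  proof -
    have gl: "(\<lambda>t. g (pt \<xi> t q)) \<in> borel_measurable lebesgue"
      using gsec[of q] by (intro measurable_completion) simp
    have e: "AE t in lebesgue. f (pt \<xi> t q) = g (pt \<xi> t q)"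
      using that by (rule AE_completion)
    have fl: "(\<lambda>t. f (pt \<xi> t q)) \<in> borel_measurable lebesgue"
      using e by (intro borel_measurable_AE[OF gl]) (auto elim: AE_mp)
    have "integrable lebesgue (\<lambda>t. f (pt \<xi> t q)) = integrable lebesgue (\<lambda>t. g (pt \<xi> t q))"
      "(LINT t|lebesgue. f (pt \<xi> t q)) = (LINT t|lebesgue. g (pt \<xi> t q))"
      using integrable_cong_AE[OF fl gl e] integral_cong_AE[OF fl gl e] by auto
    then show ?thesis
      using gsec[of q] by (simp add: integrable_completion integral_completion)
  qed
  have "AE q in lborel. integrable lborel (\<lambda>t. g (pt \<xi> t q))"
    using lborel_pair.AE_integrable_fst[OF G] .
  with ae have "AE q in lborel. integrable lebesgue (\<lambda>t. f (pt \<xi> t q))"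
    by eventually_elim (use line in blast)
  then show "AE q in lebesgue. integrable lebesgue (\<lambda>t. f (pt \<xi> t q))"
    by (rule AE_completion)
  have m: "(\<lambda>q. LINT t|lborel. g (pt \<xi> t q)) \<in> borel_measurable lborel"
    using lborel_pair.integrable_fst[OF G] by auto
  have m1: "(\<lambda>q. LINT t|lborel. g (pt \<xi> t q)) \<in> borel_measurable lebesgue"
    using m by (rule measurable_completion)
  have e: "AE q in lebesgue. (LINT t|lborel. g (pt \<xi> t q)) = (LINT t|lebesgue. f (pt \<xi> t q))"
    using AE_completion[OF ae] by eventually_elim (use line in simp)
  show m2: "(\<lambda>q. LINT t|lebesgue. f (pt \<xi> t q)) \<in> borel_measurable lebesgue"
    using m1 e by (rule borel_measurable_AE)
  have "integral\<^sup>L lebesgue f = integral\<^sup>L lborel g"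
    using integral_cong_AE[OF _ gL AE_completion[OF fg]] f g by (simp add: integral_completion)
  also have "\<dots> = integral\<^sup>L (distr lborel lborel (\<lambda>(q, t). pt \<xi> t q)) g"
    by (simp add: pt_lborel)
  also have "\<dots> = (LINT x|(lborel \<Otimes>\<^sub>M lborel). (case x of (q, t) \<Rightarrow> g (pt \<xi> t q)))"
    using g mpt by (subst integral_distr) (auto simp: lborel_prod case_prod_beta')
  also have "\<dots> = (LINT q|lborel. LINT t|lborel. g (pt \<xi> t q))"
    using lborel_pair.integral_fst[OF G] by simp
  also have "\<dots> = (LINT q|lebesgue. LINT t|lborel. g (pt \<xi> t q))"
    using m by (simp add: integral_completion)
  also have "\<dots> = (LINT q|lebesgue. LINT t|lebesgue. f (pt \<xi> t q))"
    by (rule integral_cong_AE[OF m1 m2 e])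
  finally show "integral\<^sup>L lebesgue f = (LINT q|lebesgue. LINT t|lebesgue. f (pt \<xi> t q))" .
qed

section \<open>The chain rule for primitives of integrable functions\<close>

text \<open>
  The square $\{(x, y)\}$ is cut along its diagonal; each of the two triangles yields one of the two
  terms of integration by parts. No differentiation of the primitives is involved.
\<close>
lemma Fubini_triangle:
  fixes f g :: "real \<Rightarrow> real"
  assumes f: "integrable lborel f" and g: "integrable lborel g"
  shows "integrable lborel (\<lambda>t. (LINT x:{..t}|lborel. f x) * g t)"
    and "integrable lborel (\<lambda>t. f t * (LINT x:{..<t}|lborel. g x))"
    and "(LINT t|lborel. (LINT x:{..t}|lborel. f x) * g t)
           + (LINT t|lborel. f t * (LINT x:{..<t}|lborel. g x))
         = (LINT x|lborel. f x) * (LINT x|lborel. g x)"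
proof -
  have [measurable]: "f \<in> borel_measurable borel" "g \<in> borel_measurable borel"
    using f g by auto
  let ?h = "\<lambda>(x, y). f x * g y"
  have h: "integrable (lborel \<Otimes>\<^sub>M lborel) ?h"
    by (rule lborel_pair.Fubini_integrable)
      (use f g in \<open>auto simp: abs_mult\<close>)
  let ?T = "{p::real \<times> real. fst p \<le> snd p}"
  have T: "?T \<in> sets (lborel \<Otimes>\<^sub>M lborel)"
    unfolding lborel_prod sets_lborel
    by (intro borel_closed closed_Collect_le continuous_intros)
  have h1: "integrable (lborel \<Otimes>\<^sub>M lborel) (\<lambda>(x, y). indicator {..y} x * f x * g y)"
    using integrable_real_mult_indicator[OF T h]
    by (rule back_subst[where P="integrable _"]) (auto simp: fun_eq_iff indicator_def)
  \<comment> \<open>The complementary triangle is half-open, so that the diagonal is counted once.\<close>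
  have h2: "integrable (lborel \<Otimes>\<^sub>M lborel) (\<lambda>(x, y). f x * (indicator {..<x} y * g y))"
    using Bochner_Integration.integrable_diff[OF h h1]
    by (rule back_subst[where P="integrable _"]) (auto simp: fun_eq_iff indicator_def)
  have e1: "(LINT x|lborel. indicator {..t} x * f x * g t) = (LINT x:{..t}|lborel. f x) * g t" for t
    by (simp add: set_lebesgue_integral_def)
  have e2: "(LINT y|lborel. f t * (indicator {..<t} y * g y)) = f t * (LINT x:{..<t}|lborel. g x)" for t
    by (simp add: set_lebesgue_integral_def)
  show "integrable lborel (\<lambda>t. (LINT x:{..t}|lborel. f x) * g t)"
    using lborel_pair.integrable_snd[OF h1] unfolding e1 .
  show "integrable lborel (\<lambda>t. f t * (LINT x:{..<t}|lborel. g x))"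
    using lborel_pair.integrable_fst[OF h2] unfolding e2 .
  have "(LINT x|lborel. f x) * (LINT x|lborel. g x) = integral\<^sup>L (lborel \<Otimes>\<^sub>M lborel) ?h"
    using lborel_pair.integral_fst[OF h] by simp
  also have "\<dots> = (LINT p|(lborel \<Otimes>\<^sub>M lborel). (case p of (x, y) \<Rightarrow> indicator {..y} x * f x * g y)
       + (case p of (x, y) \<Rightarrow> f x * (indicator {..<x} y * g y)))"
    by (rule Bochner_Integration.integral_cong) (auto simp: indicator_def)
  also have "\<dots> = (LINT t|lborel. (LINT x:{..t}|lborel. f x) * g t)
           + (LINT t|lborel. f t * (LINT x:{..<t}|lborel. g x))"
    using lborel_pair.integral_snd[OF h1] lborel_pair.integral_fst[OF h2]
    unfolding e1 e2 Bochner_Integration.integral_add[OF h1 h2] by simp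
  finally show "(LINT t|lborel. (LINT x:{..t}|lborel. f x) * g t)
           + (LINT t|lborel. f t * (LINT x:{..<t}|lborel. g x))
         = (LINT x|lborel. f x) * (LINT x|lborel. g x)" ..
qed

text \<open>
  Carries an integrand on an interval over to Borel measure on the whole line, where the triangle
  argument is available.
\<close>
lemma absolutely_integrable_on_borel_version:
  fixes f :: "real \<Rightarrow> real"
  assumes f: "f absolutely_integrable_on {a..b}"
  obtains f' where "integrable lborel f'" "AE t in lborel. f' t = indicator {a..b} t * f t"
proof -
  have i: "integrable lebesgue (\<lambda>t. indicator {a..b} t * f t)"
    using f by (simp add: set_integrable_def)
  then obtain f' where f': "f' \<in> borel_measurable lborel"
      and ff': "AE t in lborel. indicator {a..b} t * f t = f' t"
    using completion_ex_borel_measurable_real[of "\<lambda>t. indicator {a..b} t * f t" lborel] by auto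
  have "integrable lebesgue f'"
    using integrable_cong_AE_imp[OF i measurable_completion[OF f']] AE_completion[OF ff']
    by (auto elim: AE_mp)
  then have "integrable lborel f'"
    using f' by (simp add: integrable_completion)
  moreover have "AE t in lborel. f' t = indicator {a..b} t * f t"
    using ff' by (auto elim: AE_mp)
  ultimately show thesis using that by blast
qed

lemma primitive_eq_lborel:
  fixes f f' :: "real \<Rightarrow> real"
  assumes f: "f absolutely_integrable_on {a..b}" and f': "integrable lborel f'"
    and ae: "AE t in lborel. f' t = indicator {a..b} t * f t" and t: "t \<in> {a..b}"
  shows "(LINT x:{..t}|lborel. f' x) = integral {a..t} f"
    and "(LINT x:{..<t}|lborel. f' x) = integral {a..t} f"
proof -
  have sub: "f absolutely_integrable_on {a..t}"
    using f by (rule absolutely_integrable_on_subinterval) (use t in auto)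
  have m: "(\<lambda>x. indicator {a..t} x *\<^sub>R f x) \<in> borel_measurable lebesgue"
    using sub by (auto simp: set_integrable_def)
  have m': "f' \<in> borel_measurable borel" using f' by auto
  have "(LINT x:{..t}|lborel. f' x) = (LINT x|lebesgue. indicator {..t} x *\<^sub>R f' x)"
    unfolding set_lebesgue_integral_def using m' by (subst integral_completion) auto
  also have "\<dots> = (LINT x|lebesgue. indicator {a..t} x *\<^sub>R f x)"
  proof (rule integral_cong_AE[OF _ m])
    show "(\<lambda>x. indicator {..t} x *\<^sub>R f' x) \<in> borel_measurable lebesgue"
      using m' by (intro measurable_completion) auto
    show "AE x in lebesgue. indicator {..t} x *\<^sub>R f' x = indicator {a..t} x *\<^sub>R f x"
      using AE_completion[OF ae] by eventually_elim (use t in \<open>auto simp: indicator_def\<close>)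
  qed
  also have "\<dots> = integral {a..t} f"
    using set_lebesgue_integral_eq_integral(2)[OF sub] by (simp add: set_lebesgue_integral_def)
  finally show 1: "(LINT x:{..t}|lborel. f' x) = integral {a..t} f" .
  have "(LINT x:{..<t}|lborel. f' x) = (LINT x:{..t}|lborel. f' x)"
    unfolding set_lebesgue_integral_def
  proof (rule integral_cong_AE)
    show "AE x in lborel. indicator {..<t} x *\<^sub>R f' x = indicator {..t} x *\<^sub>R f' x"
      using AE_lborel_singleton[of t] by eventually_elim (auto simp: indicator_def)
  qed (use m' in auto)
  with 1 show "(LINT x:{..<t}|lborel. f' x) = integral {a..t} f" by simp
qed

lemma primitives_integral_by_parts:
  fixes f g :: "real \<Rightarrow> real"
  assumes f: "f absolutely_integrable_on {a..b}" and g: "g absolutely_integrable_on {a..b}"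
    and ab: "a \<le> b"
  shows "((\<lambda>t. integral {a..t} f * g t + f t * integral {a..t} g) has_integral
           integral {a..b} f * integral {a..b} g) {a..b}"
proof -
  obtain f' where f': "integrable lborel f'" and fae: "AE t in lborel. f' t = indicator {a..b} t * f t"
    using absolutely_integrable_on_borel_version[OF f] .
  obtain g' where g': "integrable lborel g'" and gae: "AE t in lborel. g' t = indicator {a..b} t * g t"
    using absolutely_integrable_on_borel_version[OF g] .
  note F = primitive_eq_lborel[OF f f' fae] and G = primitive_eq_lborel[OF g g' gae]
  note tri = Fubini_triangle[OF f' g']
  let ?H = "\<lambda>t. (LINT x:{..t}|lborel. f' x) * g' t + f' t * (LINT x:{..<t}|lborel. g' x)"
  have full: "(LINT x|lborel. k' x) = integral {a..b} k"
    if k: "k absolutely_integrable_on {a..b}" and k': "integrable lborel k'"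
      and ae: "AE t in lborel. k' t = indicator {a..b} t * k t" for k k' :: "real \<Rightarrow> real"
  proof -
    have "(LINT x|lborel. k' x) = (LINT x|lebesgue. k' x)"
      using k' by (simp add: integral_completion)
    also have "\<dots> = (LINT x|lebesgue. indicator {a..b} x *\<^sub>R k x)"
    proof (rule integral_cong_AE)
      show "k' \<in> borel_measurable lebesgue"
        using k' by (intro measurable_completion) auto
      show "(\<lambda>x. indicator {a..b} x *\<^sub>R k x) \<in> borel_measurable lebesgue"
        using k unfolding set_integrable_def by auto
      show "AE x in lebesgue. k' x = indicator {a..b} x *\<^sub>R k x"
        using AE_completion[OF ae] by simp
    qed
    also have "\<dots> = integral {a..b} k"
      using set_lebesgue_integral_eq_integral(2)[OF k] by (simp add: set_lebesgue_integral_def)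
    finally show ?thesis .
  qed
  have Hi: "integrable lborel ?H" using tri(1,2) by (rule Bochner_Integration.integrable_add)
  have "(?H has_integral integral\<^sup>L lborel ?H) UNIV"
    using has_integral_integral_lborel[OF Hi] .
  moreover have "integral\<^sup>L lborel ?H = integral {a..b} f * integral {a..b} g"
    using tri full[OF f f' fae] full[OF g g' gae] by simp
  ultimately have H: "(?H has_integral integral {a..b} f * integral {a..b} g) UNIV"
    by simp
  obtain N where N: "negligible N" "\<And>t. t \<notin> N \<Longrightarrow>
      f' t = indicator {a..b} t * f t \<and> g' t = indicator {a..b} t * g t"
  proof -
    have "AE t in lebesgue. f' t = indicator {a..b} t * f t \<and> g' t = indicator {a..b} t * g t"
      using AE_completion[OF fae] AE_completion[OF gae] by eventually_elim auto
    then show thesis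
      using that unfolding completion.AE_iff_null_sets negligible_iff_null_sets by auto
  qed
  have "((\<lambda>t. if t \<in> {a..b} then integral {a..t} f * g t + f t * integral {a..t} g else 0)
      has_integral integral {a..b} f * integral {a..b} g) UNIV"
    by (rule has_integral_spike[OF N(1) _ H]) (use F G N(2) in auto)
  then show ?thesis by (simp only: has_integral_restrict_UNIV)
qed

text \<open>
  This is $\frac{d}{dt} B(u, u) = 2 B(u, u')$ in integrated form for $u = K + \int w$. After
  expansion in coordinates, symmetry of \<open>B\<close> pairs each term $u_i w_j$ with $u_j w_i$, and integration
  by parts applies to each pair.
\<close>
lemma primitive_bilinear_chain_rule:
  fixes w :: "real \<Rightarrow> 'a::euclidean_space" and B :: "'a \<Rightarrow> 'a \<Rightarrow> real"
  assumes bil: "bounded_bilinear B" and sym: "\<And>x y. B x y = B y x"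
    and w: "w absolutely_integrable_on {a..b}" and ab: "a \<le> b"
  shows "((\<lambda>t. B (K + integral {a..t} w) (w t)) has_integral
           (B (K + integral {a..b} w) (K + integral {a..b} w) - B K K) / 2) {a..b}"
proof -
  interpret bounded_bilinear B by fact
  let ?W = "\<lambda>t. integral {a..t} w"
  have wi: "w integrable_on {a..t}" if "t \<in> {a..b}" for t
    using set_lebesgue_integral_eq_integral(1)[OF w] that by (auto intro: integrable_on_subinterval)
  have comp: "integral {a..t} (\<lambda>s. w s \<bullet> i) = ?W t \<bullet> i" if "t \<in> {a..b}" for t i
    using integral_component_eq[OF wi[OF that]] by simp
  have expand: "B x y = (\<Sum>i\<in>Basis. \<Sum>j\<in>Basis. (x \<bullet> i) * (y \<bullet> j) * B i j)" for x y
  proof -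
    have "B x y = B (\<Sum>i\<in>Basis. (x \<bullet> i) *\<^sub>R i) (\<Sum>j\<in>Basis. (y \<bullet> j) *\<^sub>R j)"
      by (simp add: euclidean_representation)
    then show ?thesis
      by (subst sum.swap) (simp add: sum_left sum_right scaleR_left scaleR_right
          sum_distrib_left mult_ac)
  qed
  have wc: "(\<lambda>t. w t \<bullet> i) absolutely_integrable_on {a..b}" if "i \<in> Basis" for i
    using w absolutely_integrable_componentwise_iff[where f = w] that by blast
  have base: "((\<lambda>t. ((?W t \<bullet> i) * (w t \<bullet> j) + (w t \<bullet> i) * (?W t \<bullet> j)) * (B i j / 2)) has_integral
      (?W b \<bullet> i) * (?W b \<bullet> j) * (B i j / 2)) {a..b}" if "i \<in> Basis" "j \<in> Basis" for i j
  proof (rule has_integral_mult_left)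
    have "((\<lambda>t. integral {a..t} (\<lambda>s. w s \<bullet> i) * (w t \<bullet> j) + (w t \<bullet> i) * integral {a..t} (\<lambda>s. w s \<bullet> j))
        has_integral integral {a..b} (\<lambda>s. w s \<bullet> i) * integral {a..b} (\<lambda>s. w s \<bullet> j)) {a..b}"
      using primitives_integral_by_parts[OF wc[OF that(1)] wc[OF that(2)] ab] .
    then have "((\<lambda>t. integral {a..t} (\<lambda>s. w s \<bullet> i) * (w t \<bullet> j) + (w t \<bullet> i) * integral {a..t} (\<lambda>s. w s \<bullet> j))
        has_integral (?W b \<bullet> i) * (?W b \<bullet> j)) {a..b}"
      using ab by (simp add: comp)
    then show "((\<lambda>t. (?W t \<bullet> i) * (w t \<bullet> j) + (w t \<bullet> i) * (?W t \<bullet> j)) has_integral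
      (?W b \<bullet> i) * (?W b \<bullet> j)) {a..b}"
      by (rule has_integral_eq[rotated]) (simp add: comp)
  qed
  have "((\<lambda>t. \<Sum>i\<in>Basis. \<Sum>j\<in>Basis. ((?W t \<bullet> i) * (w t \<bullet> j) + (w t \<bullet> i) * (?W t \<bullet> j)) * (B i j / 2))
      has_integral (\<Sum>i\<in>Basis. \<Sum>j\<in>Basis. (?W b \<bullet> i) * (?W b \<bullet> j) * (B i j / 2))) {a..b}"
    by (intro has_integral_sum base) auto
  moreover have "(\<Sum>i\<in>Basis. \<Sum>j\<in>Basis. ((?W t \<bullet> i) * (w t \<bullet> j) + (w t \<bullet> i) * (?W t \<bullet> j)) * (B i j / 2))
      = B (?W t) (w t)" for t
  proof -
    have "B (?W t) (w t) = B (?W t) (w t) / 2 + B (w t) (?W t) / 2"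
      using sym[of "w t" "?W t"] by simp
    also have "\<dots> = (\<Sum>i\<in>Basis. \<Sum>j\<in>Basis. ((?W t \<bullet> i) * (w t \<bullet> j) + (w t \<bullet> i) * (?W t \<bullet> j)) * (B i j / 2))"
      unfolding expand[of "?W t" "w t"] expand[of "w t" "?W t"]
      by (simp add: sum_divide_distrib sum.distrib[symmetric] algebra_simps)
    finally show ?thesis ..
  qed
  moreover have "(\<Sum>i\<in>Basis. \<Sum>j\<in>Basis. (?W b \<bullet> i) * (?W b \<bullet> j) * (B i j / 2)) = B (?W b) (?W b) / 2"
    unfolding expand[of "?W b" "?W b"] by (simp add: sum_divide_distrib)
  ultimately have "((\<lambda>t. B (?W t) (w t)) has_integral B (?W b) (?W b) / 2) {a..b}"
    by (simp only:)
  moreover have "((\<lambda>t. B K (w t)) has_integral B K (?W b)) {a..b}"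
    using has_integral_linear[OF integrable_integral bounded_linear_right[of K]] wi[of b] ab
    by (auto simp: o_def)
  ultimately have "((\<lambda>t. B K (w t) + B (?W t) (w t)) has_integral B K (?W b) + B (?W b) (?W b) / 2) {a..b}"
    by (rule has_integral_add[rotated])
  moreover have "B K (?W b) + B (?W b) (?W b) / 2 = (B (K + ?W b) (K + ?W b) - B K K) / 2"
    using sym[of K "?W b"] by (simp add: add_left add_right field_simps)
  ultimately show ?thesis by (simp add: add_left)
qed

section \<open>Flux balance on a line crossing the grid\<close>

text \<open>
  An absolutely continuous function with integrable derivative extends continuously to the closed
  interval, so it differs from a primitive by the constant \<open>La\<close>. This yields the existence of the
  one-sided limits together with the balance.
\<close>
lemma slab_flux:
  fixes u w :: "real \<Rightarrow> 'a::euclidean_space" and B :: "'a \<Rightarrow> 'a \<Rightarrow> real"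
  assumes bil: "bounded_bilinear B" and sym: "\<And>x y. B x y = B y x"
    and ab: "a < b" and w: "w absolutely_integrable_on {a..b}"
    and u: "\<And>r t. a < r \<Longrightarrow> r \<le> t \<Longrightarrow> t < b \<Longrightarrow> u t - u r = integral {r..t} w"
  obtains La Lb where "(u \<longlongrightarrow> La) (at_right a)" "(u \<longlongrightarrow> Lb) (at_left b)"
    "((\<lambda>t. B (u t) (w t)) has_integral (B Lb Lb - B La La) / 2) {a..b}"
proof -
  interpret bounded_bilinear B by fact
  let ?W = "\<lambda>t. integral {a..t} w"
  have wi: "w integrable_on {a..b}" using set_lebesgue_integral_eq_integral(1)[OF w] .
  \<comment> \<open>Any interior point would do; \<open>u\<close> may have arbitrary values at the end points.\<close>
  define K where "K = u ((a + b) / 2) - ?W ((a + b) / 2)"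
  have step: "u t - ?W t = u r - ?W r" if "a < r" "r \<le> t" "t < b" for r t
  proof -
    have "?W r + integral {r..t} w = ?W t"
      using that wi by (intro Henstock_Kurzweil_Integration.integral_combine)
        (auto intro: integrable_on_subinterval)
    then show ?thesis using u[OF that] by (simp add: algebra_simps)
  qed
  have uK: "u t = K + ?W t" if "a < t" "t < b" for t
  proof -
    have "u t - ?W t = K"
      using step[of t "(a + b) / 2"] step[of "(a + b) / 2" t] that ab unfolding K_def
      by (cases "t \<le> (a + b) / 2") auto
    then show ?thesis by (simp add: algebra_simps)
  qed
  have cont: "continuous_on {a..b} (\<lambda>t. K + ?W t)"
    by (intro continuous_intros indefinite_integral_continuous_1 wi)
  have "((\<lambda>t. K + ?W t) \<longlongrightarrow> K) (at_right a)"
    using continuous_on_Icc_at_rightD[OF cont ab] by simp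
  then have 1: "(u \<longlongrightarrow> K) (at_right a)"
    by (rule Lim_transform_eventually)
      (use ab uK in \<open>auto simp: eventually_at_right[OF ab] intro!: exI[of _ b]\<close>)
  have "((\<lambda>t. K + ?W t) \<longlongrightarrow> K + ?W b) (at_left b)"
    using continuous_on_Icc_at_leftD[OF cont ab] .
  then have 2: "(u \<longlongrightarrow> K + ?W b) (at_left b)"
    by (rule Lim_transform_eventually)
      (use ab uK in \<open>auto simp: eventually_at_left[OF ab] intro!: exI[of _ a]\<close>)
  \<comment> \<open>The values at the end points are irrelevant to the integral.\<close>
  have "((\<lambda>t. B (u t) (w t)) has_integral (B (K + ?W b) (K + ?W b) - B K K) / 2) {a..b}"
    by (rule has_integral_spike_finite[OF _ _ primitive_bilinear_chain_rule[OF bil sym w, of K],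
          of "{a, b}"]) (use ab uK in auto)
  with 1 2 show thesis using that by blast
qed

lemma grid_less: "grid n h \<Longrightarrow> i < j \<Longrightarrow> j \<le> n \<Longrightarrow> h i < h j"
proof (induction j)
  case (Suc j)
  then show ?case unfolding grid_def
    by (metis Suc_le_lessD less_Suc_eq less_imp_le_nat less_trans)
qed simp

lemma grid_pos: "grid n h \<Longrightarrow> 0 < n"
  unfolding grid_def by (cases n) auto

lemma grid_cover:
  assumes "grid n h" "x \<in> {-1..1}" "\<forall>i\<le>n. x \<noteq> h i"
  shows "\<exists>i<n. h i < x \<and> x < h (Suc i)"
proof -
  have "x < h m \<Longrightarrow> m \<le> n \<Longrightarrow> \<exists>i<m. h i < x \<and> x < h (Suc i)" for m
  proof (induction m)
    case 0
    then show ?case using assms by (auto simp: grid_def)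
  next
    case (Suc m)
    show ?case
    proof (cases "x < h m")
      case True
      then show ?thesis using Suc by (auto intro: less_SucI)
    next
      case False
      with Suc.prems assms(3) have "h m < x" by (metis Suc_leD not_less_iff_gr_or_eq)
      then show ?thesis using Suc.prems by blast
    qed
  qed
  from this[of n] show ?thesis using assms unfolding grid_def
    by (metis atLeastAtMost_iff le_refl order_le_less)
qed

text \<open>
  The slab balances telescope: at an interior grid point the limits from the two sides may differ,
  but the flux \<open>B\<close> takes the same value on both, and only the two outermost limits survive.
\<close>
lemma column_flux:
  fixes u w :: "real \<Rightarrow> 'a::euclidean_space" and B :: "'a \<Rightarrow> 'a \<Rightarrow> real"
  assumes bil: "bounded_bilinear B" and sym: "\<And>x y. B x y = B y x"
    and gr: "grid n h"
    and w: "\<And>i. i < n \<Longrightarrow> w absolutely_integrable_on {h i..h (Suc i)}"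
    and u: "\<And>i r t. i < n \<Longrightarrow> h i < r \<Longrightarrow> r \<le> t \<Longrightarrow> t < h (Suc i) \<Longrightarrow> u t - u r = integral {r..t} w"
    and jump: "\<And>i. i \<in> {1..<n} \<Longrightarrow>
        B (Lim (at_right (h i)) u) (Lim (at_right (h i)) u)
          = B (Lim (at_left (h i)) u) (Lim (at_left (h i)) u)"
  shows "((\<lambda>t. B (u t) (w t)) has_integral
           (B (Lim (at_left 1) u) (Lim (at_left 1) u)
             - B (Lim (at_right (-1)) u) (Lim (at_right (-1)) u)) / 2) {-1..1}"
proof -
  let ?R = "\<lambda>i. B (Lim (at_right (h i)) u) (Lim (at_right (h i)) u)"
  let ?L = "\<lambda>i. B (Lim (at_left (h i)) u) (Lim (at_left (h i)) u)"
  have slab: "((\<lambda>t. B (u t) (w t)) has_integral (?L (Suc i) - ?R i) / 2) {h i..h (Suc i)}"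
    if i: "i < n" for i
  proof -
    have lt: "h i < h (Suc i)" using gr i by (simp add: grid_def)
    obtain La Lb where "(u \<longlongrightarrow> La) (at_right (h i))" "(u \<longlongrightarrow> Lb) (at_left (h (Suc i)))"
      and *: "((\<lambda>t. B (u t) (w t)) has_integral (B Lb Lb - B La La) / 2) {h i..h (Suc i)}"
      by (rule slab_flux[OF bil sym lt w[OF i] u[OF i]])
    then have "Lim (at_right (h i)) u = La" "Lim (at_left (h (Suc i))) u = Lb"
      by (auto intro: tendsto_Lim)
    with * show ?thesis by simp
  qed
  have "((\<lambda>t. B (u t) (w t)) has_integral (?L (Suc m) - ?R 0) / 2) {h 0..h (Suc m)}" if "m < n" for m
    using that
  proof (induction m)
    case 0
    then show ?case using slab[of 0] by simp
  next
    case (Suc m)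
    have "((\<lambda>t. B (u t) (w t)) has_integral (?L (Suc m) - ?R 0) / 2 + (?L (Suc (Suc m)) - ?R (Suc m)) / 2)
        {h 0..h (Suc (Suc m))}"
    proof (rule has_integral_combine[where c = "h (Suc m)"])
      show "h 0 \<le> h (Suc m)" "h (Suc m) \<le> h (Suc (Suc m))"
        using grid_less[OF gr] Suc.prems by (auto intro!: less_imp_le)
    qed (use Suc slab in auto)
    moreover have "(?L (Suc m) - ?R 0) / 2 + (?L (Suc (Suc m)) - ?R (Suc m)) / 2
        = (?L (Suc (Suc m)) - ?R 0) / 2"
      using jump[of "Suc m"] Suc.prems by (simp add: diff_divide_distrib)
    ultimately show ?case by (simp only:)
  qed
  from this[of "n - 1"] show ?thesis
    using gr grid_pos[OF gr] by (simp add: grid_def)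
qed

section \<open>Quadratic forms, material matrices and boundary signs\<close>

text \<open>
  Everything below is about real parts, and the real part of the Hermitian product is the Euclidean
  inner product of the underlying real space; so the real bilinear theory above applies to complex
  states.
\<close>
lemma Re_hdot: "Re (hdot u w) = u \<bullet> w"
  by (simp add: hdot_def inner_vec_def inner_complex_def)

lemma inner_cmat: "x \<bullet> (cmat M *v y) = (\<Sum>i\<in>UNIV. \<Sum>j\<in>UNIV. M $ i $ j * (x $ i \<bullet> y $ j))"
  by (simp add: inner_vec_def matrix_vector_mult_def cmat_def map_matrix_def inner_sum_right
      scaleR_conv_of_real[symmetric])

lemma linear_cmat: "linear (\<lambda>y. cmat M *v y)"
  by simp

lemma bounded_bilinear_form: "bounded_bilinear (\<lambda>x y. x \<bullet> (cmat M *v y))"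
  by (rule bounded_bilinear.comp[OF bounded_bilinear_inner bounded_linear_ident])
    (simp add: linear_conv_bounded_linear[symmetric])

lemma sum_Plus_UNIV: "(\<Sum>i\<in>UNIV. f i) = (\<Sum>i\<in>UNIV. f (Inl i)) + (\<Sum>i\<in>UNIV. f (Inr i))"
  for f :: "'a::finite + 'b::finite \<Rightarrow> 'c::comm_monoid_add"
  unfolding UNIV_Plus_UNIV[symmetric] by (subst sum.Plus) auto

lemma transpose_entry: "transpose M = M \<Longrightarrow> M $ i $ j = M $ j $ i"
  by (metis (no_types) transpose_def vec_lambda_beta)

lemma form_symmetric:
  assumes "transpose M = M"
  shows "x \<bullet> (cmat M *v y) = y \<bullet> (cmat M *v x)"
proof -
  note M = transpose_entry[OF assms]
  show ?thesis
    unfolding inner_cmat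
  proof (subst sum.swap, intro sum.cong refl)
    show "M $ j $ i * (x $ j \<bullet> y $ i) = M $ i $ j * (y $ i \<bullet> x $ j)" for i j
      using M[of i j] by (simp add: inner_commute)
  qed
qed

lemma hdot_cmat_real:
  assumes "transpose M = M"
  shows "hdot x (cmat M *v x) = of_real (x \<bullet> (cmat M *v x))"
proof -
  note M = transpose_entry[OF assms]
  have e: "hdot x (cmat M *v x) = (\<Sum>i\<in>UNIV. \<Sum>j\<in>UNIV. of_real (M $ i $ j) * (cnj (x $ i) * x $ j))"
    by (simp add: hdot_def matrix_vector_mult_def cmat_def map_matrix_def sum_distrib_left mult_ac)
  have "cnj (hdot x (cmat M *v x)) = hdot x (cmat M *v x)"
    unfolding e
  proof (simp, subst sum.swap, intro sum.cong refl)
    show "of_real (M $ j $ i) * (x $ j * cnj (x $ i)) = of_real (M $ i $ j) * (cnj (x $ i) * x $ j)"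
      for i j using M[of i j] by simp
  qed
  then have "hdot x (cmat M *v x) = of_real (Re (hdot x (cmat M *v x)))"
    by (metis Reals_cnj_iff of_real_Re)
  then show ?thesis by (simp add: Re_hdot)
qed

text \<open>
  A real matrix acts separately on real and imaginary parts, so the form on complex vectors is the
  sum of its values on the two parts.
\<close>
lemma form_nonneg:
  assumes "\<And>v. v \<bullet> (M *v v) \<ge> 0"
  shows "x \<bullet> (cmat M *v x) \<ge> 0"
proof -
  let ?r = "\<chi> i. Re (x $ i)" and ?m = "\<chi> i. Im (x $ i)"
  have "x \<bullet> (cmat M *v x) = ?r \<bullet> (M *v ?r) + ?m \<bullet> (M *v ?m)"
    unfolding inner_cmat
    by (simp add: inner_vec_def matrix_vector_mult_def inner_complex_def sum_distrib_left
        sum.distrib[symmetric] algebra_simps)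
  then show ?thesis using assms[of ?r] assms[of ?m] by simp
qed

lemma transpose_Amat: "transpose (Amat \<xi>) = Amat \<xi>"
  by (auto simp: transpose_def Amat_def vec_eq_iff split: sum.split)

text \<open>
  The matrix couples velocity and stress in both orders, hence the factor $2$: the energy flux is
  twice the power $v \cdot T$. In particular it depends on the state only through velocity and
  traction, which are exactly the quantities that the interface conditions match.
\<close>
lemma Amat_form:
  "x \<bullet> (cmat (Amat \<xi>) *v x) = 2 * (vel x \<bullet> traction \<xi> x)"
proof -
  have "vel x \<bullet> traction \<xi> x = (\<Sum>i\<in>UNIV. \<Sum>j\<in>UNIV. amat \<xi> $ i $ j * (x $ Inl i \<bullet> x $ Inr j))"
    unfolding traction_def inner_cmat by (simp add: vel_def stress_def)
  moreover have "(\<Sum>j\<in>UNIV. \<Sum>i\<in>UNIV. amat \<xi> $ i $ j * (x $ Inr j \<bullet> x $ Inl i))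
      = (\<Sum>i\<in>UNIV. \<Sum>j\<in>UNIV. amat \<xi> $ i $ j * (x $ Inl i \<bullet> x $ Inr j))"
    by (subst sum.swap) (simp add: inner_commute)
  ultimately show ?thesis
    unfolding inner_cmat sum_Plus_UNIV by (simp add: Amat_def)
qed

lemma Pmat_form:
  "v \<bullet> (Pmat \<rho> C *v v) = inverse \<rho> * (\<Sum>i\<in>UNIV. (v $ Inl i)\<^sup>2) + (\<chi> i. v $ Inr i) \<bullet> (C *v (\<chi> i. v $ Inr i))"
proof -
  show ?thesis
    by (simp add: inner_vec_def matrix_vector_mult_def Pmat_def sum_Plus_UNIV
        mult_delta_left mult_delta_right sum_distrib_left power2_eq_square mult_ac)
qed

lemma sym_pos_def_Pmat:
  assumes "\<rho> > 0" "sym_pos_def C"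
  shows "sym_pos_def (Pmat \<rho> C)"
  unfolding sym_pos_def_def
proof (intro conjI allI impI)
  have "C $ i $ j = C $ j $ i" for i j
    using assms(2) unfolding sym_pos_def_def by (intro transpose_entry) simp
  then show "transpose (Pmat \<rho> C) = Pmat \<rho> C"
    by (auto simp: transpose_def Pmat_def vec_eq_iff split: sum.split)
  fix v :: "real ^ (3 + 6)" assume v: "v \<noteq> 0"
  let ?s = "\<chi> i. v $ Inr i"
  have C0: "?s \<bullet> (C *v ?s) \<ge> 0"
    using assms(2) unfolding sym_pos_def_def by (cases "?s = 0") (auto intro: less_imp_le)
  show "v \<bullet> (Pmat \<rho> C *v v) > 0"
  proof (cases "?s = 0")
    case False
    then have "?s \<bullet> (C *v ?s) > 0" using assms(2) unfolding sym_pos_def_def by blast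
    then show ?thesis unfolding Pmat_form using assms(1)
      by (simp add: add_nonneg_pos sum_nonneg)
  next
    case True
    \<comment> \<open>The stress part vanishes, so the velocity part cannot.\<close>
    then have inr: "v $ Inr i = 0" for i by (simp add: vec_eq_iff)
    obtain k where k: "v $ k \<noteq> 0" using v by (auto simp: vec_eq_iff)
    then obtain i where "v $ Inl i \<noteq> 0" using inr by (cases k) auto
    then have "(\<Sum>i\<in>UNIV. (v $ Inl i)\<^sup>2) > 0" by (intro sum_pos2[of _ i]) auto
    then show ?thesis unfolding Pmat_form using assms(1) C0
      by (simp add: add_pos_nonneg)
  qed
qed

lemma sym_pos_def_inverse:
  fixes P :: "real ^ 'n ^ 'n"
  assumes "sym_pos_def P"
  shows "matrix_inv P ** P = mat 1" "P ** matrix_inv P = mat 1"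
    and "transpose (matrix_inv P) = matrix_inv P" "v \<bullet> (matrix_inv P *v v) \<ge> 0"
proof -
  have sym: "transpose P = P" and pos: "\<And>v. v \<noteq> 0 \<Longrightarrow> v \<bullet> (P *v v) > 0"
    using assms by (auto simp: sym_pos_def_def)
  have "\<forall>x. P *v x = 0 \<longrightarrow> x = 0"
    using pos by (metis inner_zero_right less_irrefl)
  then have "invertible P"
    using matrix_left_invertible_ker[of P] invertible_left_inverse by blast
  then show 1: "matrix_inv P ** P = mat 1" and 2: "P ** matrix_inv P = mat 1"
    unfolding invertible_def matrix_inv_def by (metis (mono_tags, lifting) someI_ex)+
  have "transpose (matrix_inv P) ** P = mat 1"
    using arg_cong[OF 2, of transpose] by (simp add: matrix_transpose_mul sym transpose_mat)
  then show "transpose (matrix_inv P) = matrix_inv P"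
    by (metis 2 matrix_mul_assoc matrix_mul_lid matrix_mul_rid)
  let ?y = "matrix_inv P *v v"
  have "v = P *v ?y" by (simp add: matrix_vector_mul_assoc 2)
  then have "v \<bullet> ?y = ?y \<bullet> (P *v ?y)" by (metis inner_commute)
  then show "v \<bullet> ?y \<ge> 0"
    using pos[of ?y] by (cases "?y = 0") (auto intro: less_imp_le)
qed

lemma cmat_mult: "cmat A *v (cmat B *v x) = cmat (A ** B) *v x"
  unfolding matrix_vector_mul_assoc
  by (rule arg_cong[of _ _ "\<lambda>M. M *v x"])
    (simp add: cmat_def map_matrix_def matrix_matrix_mult_def vec_eq_iff)

lemma cmat_one: "cmat (mat 1) *v x = x" for x :: "complex ^ 'n"
proof -
  have "cmat (mat 1 :: real ^ 'n ^ 'n) = mat 1"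
    by (simp add: cmat_def map_matrix_def mat_def vec_eq_iff)
  then show ?thesis by simp
qed

text \<open>
  The boundary condition makes \<open>T\<close> a nonnegative real multiple of \<open>v\<close>, except for $\gamma = -1$, when
  it forces \<open>v = 0\<close>. At the opposite face the same holds for \<open>- T\<close>.
\<close>
lemma boundary_sign:
  fixes v T :: complex
  assumes Z: "Z > 0" and g: "\<bar>\<gamma>\<bar> \<le> 1"
    and bc: "of_real (Z / 2 * (1 - \<gamma>)) * v - of_real ((1 + \<gamma>) / 2) * T = 0"
  shows "v \<bullet> T \<ge> 0"
proof -
  have e: "(Z / 2 * (1 - \<gamma>)) *\<^sub>R v = ((1 + \<gamma>) / 2) *\<^sub>R T"
    using bc unfolding scaleR_conv_of_real by simp
  show ?thesis
  proof (cases "1 + \<gamma> = 0")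
    case True
    then have "v = 0" using e Z by (auto simp: algebra_simps)
    then show ?thesis by simp
  next
    case False
    then have p: "1 + \<gamma> > 0" using g by auto
    have "(1 + \<gamma>) / 2 * (v \<bullet> T) = Z / 2 * (1 - \<gamma>) * (v \<bullet> v)"
      using arg_cong[OF e, of "\<lambda>x. v \<bullet> x"] by simp
    also have "\<dots> \<ge> 0" using Z g by auto
    finally show ?thesis using p by (simp add: zero_le_mult_iff)
  qed
qed

section \<open>Square-integrable fields and the divergence identity\<close>

definition transverse :: "3 \<Rightarrow> 3" where
  "transverse \<xi> = (if \<xi> = 1 then 2 else 1)"

text \<open>
  The cells of the grid with their two indices ordered as seen from a line in direction \<open>\<xi>\<close>: first
  the position along the line, then the column. This lets both directions be treated at once.
\<close>
definition slab_cell :: "3 \<Rightarrow> (3 \<Rightarrow> nat \<Rightarrow> real) \<Rightarrow> nat \<Rightarrow> nat \<Rightarrow> pos set" where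
  "slab_cell \<xi> g k l = (if \<xi> = 1 then Cell g k l else Cell g l k)"

lemma pt_in_slab_cell:
  assumes "\<xi> \<in> {1, 2}"
  shows "pt \<xi> t q \<in> slab_cell \<xi> g k l \<longleftrightarrow> t \<in> {g \<xi> k<..<g \<xi> (Suc k)} \<and>
    q \<in> box (g (transverse \<xi>) l, -1) (g (transverse \<xi>) (Suc l), 1)"
  using assms
  by (cases q) (auto simp: slab_cell_def transverse_def Cell_def pt_def mem_box Basis_prod_def zero_prod_def)

lemma pt_in_Omega:
  assumes "\<xi> \<in> {1, 2}"
  shows "pt \<xi> t q \<in> Omega \<longleftrightarrow> t \<in> {-1..1} \<and> q \<in> Face"
  using assms
  by (cases q) (auto simp: Omega_def Face_def pt_def mem_box Basis_prod_def zero_prod_def)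

lemma Cell_lmeasurable: "Cell g i j \<in> lmeasurable" "slab_cell \<xi> g k l \<in> lmeasurable"
  by (simp_all add: slab_cell_def Cell_def)

lemma L2_on_measurable:
  assumes "L2_on S u" "S \<in> sets lebesgue"
  shows "u \<in> borel_measurable (lebesgue_on S)"
  using assms by (simp add: L2_on_def set_borel_measurable_def borel_measurable_restrict_space_iff)

lemma L2_on_norm_integrable: "L2_on S u \<Longrightarrow> (\<lambda>p. (norm (u p))\<^sup>2) integrable_on S"
  unfolding L2_on_def by (erule conjE, erule set_lebesgue_integral_eq_integral(1))

text \<open>
  The product is dominated by a multiple of $|u|^2 + |w|^2$.
\<close>
lemma L2_on_bilinear:
  fixes B :: "state \<Rightarrow> state \<Rightarrow> real"
  assumes B: "bounded_bilinear B" and S: "S \<in> sets lebesgue"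
    and u: "L2_on S u" and w: "L2_on S w"
  shows "(\<lambda>p. B (u p) (w p)) absolutely_integrable_on S"
proof -
  obtain K where K: "K > 0" "\<And>x y. norm (B x y) \<le> norm x * norm y * K"
    using bounded_bilinear.pos_bounded[OF B] by blast
  have i: "(\<lambda>p. (norm (u p))\<^sup>2) integrable_on S" "(\<lambda>p. (norm (w p))\<^sup>2) integrable_on S"
    by (rule L2_on_norm_integrable[OF u], rule L2_on_norm_integrable[OF w])
  show ?thesis
  proof (rule measurable_bounded_by_integrable_imp_absolutely_integrable)
    show "(\<lambda>p. B (u p) (w p)) \<in> borel_measurable (lebesgue_on S)"
      using B borel_measurable_bilinear[OF _ L2_on_measurable[OF u S] L2_on_measurable[OF w S] S, of B]
      by (simp add: bilinear_conv_bounded_bilinear)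
    show "(\<lambda>p. K * ((norm (u p))\<^sup>2 + (norm (w p))\<^sup>2)) integrable_on S"
      using integrable_cmul[OF Henstock_Kurzweil_Integration.integrable_add[OF i], of K] by simp
    fix p
    have "norm (u p) * norm (w p) \<le> (norm (u p))\<^sup>2 + (norm (w p))\<^sup>2"
      using sum_squares_bound[of "norm (u p)" "norm (w p)"]
        mult_nonneg_nonneg[OF norm_ge_zero norm_ge_zero, of "u p" "w p"] by linarith
    then have "norm (u p) * norm (w p) * K \<le> K * ((norm (u p))\<^sup>2 + (norm (w p))\<^sup>2)"
      using K(1) by (simp add: mult.commute)
    with K(2)[of "u p" "w p"] show "norm (B (u p) (w p)) \<le> K * ((norm (u p))\<^sup>2 + (norm (w p))\<^sup>2)"
      by (rule order_trans)
  qed (fact S)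
qed

lemma L2_onI:
  assumes "u \<in> borel_measurable (lebesgue_on S)" "S \<in> sets lebesgue"
    "(\<lambda>p. u p \<bullet> u p) absolutely_integrable_on S"
  shows "L2_on S u"
  using assms by (simp add: L2_on_def set_borel_measurable_def borel_measurable_restrict_space_iff
      power2_norm_eq_inner)

lemma L2_on_linear:
  assumes T: "linear T" and S: "S \<in> sets lebesgue" and u: "L2_on S u"
  shows "L2_on S (\<lambda>p. T (u p))"
proof (rule L2_onI)
  have b: "bounded_linear T" using T by (simp add: linear_conv_bounded_linear)
  have bb: "bounded_bilinear (\<lambda>x y. T x \<bullet> T y)"
    by (rule bounded_bilinear.comp[OF bounded_bilinear_inner b b])
  show "(\<lambda>p. T (u p)) \<in> borel_measurable (lebesgue_on S)"
    using L2_on_measurable[OF u S]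
    by (rule borel_measurable_continuous_on[rotated]) (simp add: b linear_continuous_on)
  show "(\<lambda>p. T (u p) \<bullet> T (u p)) absolutely_integrable_on S"
    using L2_on_bilinear[OF bb S u u] .
qed (fact S)

lemma L2_on_add:
  assumes S: "S \<in> sets lebesgue" and u: "L2_on S u" and w: "L2_on S w"
  shows "L2_on S (\<lambda>p. u p + w p)"
proof (rule L2_onI)
  show "(\<lambda>p. u p + w p) \<in> borel_measurable (lebesgue_on S)"
    using L2_on_measurable[OF u S] L2_on_measurable[OF w S] by simp
  note I = L2_on_bilinear[OF bounded_bilinear_inner S]
  have "(\<lambda>p. (u p \<bullet> u p + u p \<bullet> w p) + (u p \<bullet> w p + w p \<bullet> w p)) absolutely_integrable_on S"
    using I[OF u u] I[OF u w] I[OF w w] by (intro set_integral_add(1))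
  moreover have "(u p + w p) \<bullet> (u p + w p) = (u p \<bullet> u p + u p \<bullet> w p) + (u p \<bullet> w p + w p \<bullet> w p)" for p
    by (simp add: inner_add_left inner_add_right inner_commute[of "w p" "u p"])
  ultimately show "(\<lambda>p. (u p + w p) \<bullet> (u p + w p)) absolutely_integrable_on S"
    by (simp only:)
qed (fact S)

lemma L2_on_absolutely_integrable:
  assumes S: "S \<in> lmeasurable" and u: "L2_on S u"
  shows "u absolutely_integrable_on S"
proof (rule measurable_bounded_by_integrable_imp_absolutely_integrable)
  show "u \<in> borel_measurable (lebesgue_on S)"
    using L2_on_measurable[OF u] S by (simp add: fmeasurableD)
  show "(\<lambda>p. 1 + (norm (u p))\<^sup>2) integrable_on S"
    by (rule Henstock_Kurzweil_Integration.integrable_add[OF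
        integrable_on_const[OF S] L2_on_norm_integrable[OF u]])
  show "norm (u p) \<le> 1 + (norm (u p))\<^sup>2" for p
    using self_le_power[of "norm (u p)" 2] zero_le_power2[of "norm (u p)"]
    by (cases "norm (u p) \<ge> 1") (simp, linarith)
qed (use S in \<open>simp add: fmeasurableD\<close>)

text \<open>
  A cell has finite measure, so square integrability gives integrability, which passes to almost
  every line by Fubini, one component at a time.
\<close>
lemma L2_on_line_integrable:
  assumes \<xi>: "\<xi> \<in> {1, 2}" and u: "L2_on (slab_cell \<xi> g k l) u"
  shows "AE q in lebesgue. q \<in> box (g (transverse \<xi>) l, -1) (g (transverse \<xi>) (Suc l), 1) \<longrightarrow>
    (\<lambda>t. u (pt \<xi> t q)) absolutely_integrable_on {g \<xi> k..g \<xi> (Suc k)}"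
proof -
  let ?S = "slab_cell \<xi> g k l"
  have ui: "u absolutely_integrable_on ?S"
    by (rule L2_on_absolutely_integrable[OF Cell_lmeasurable(2) u])
  have "AE q in lebesgue. \<forall>b\<in>Basis. integrable lebesgue (\<lambda>t. indicator ?S (pt \<xi> t q) * (u (pt \<xi> t q) \<bullet> b))"
  proof (rule AE_finite_allI)
    fix b :: state assume "b \<in> Basis"
    then have "(\<lambda>p. u p \<bullet> b) absolutely_integrable_on ?S"
      using ui absolutely_integrable_componentwise_iff[where f = u] by blast
    then have "integrable lebesgue (\<lambda>p. indicator ?S p * (u p \<bullet> b))"
      by (simp add: set_integrable_def)
    from lebesgue_Fubini_pt(1)[OF this]
    show "AE q in lebesgue. integrable lebesgue (\<lambda>t. indicator ?S (pt \<xi> t q) * (u (pt \<xi> t q) \<bullet> b))" .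
  qed simp
  then show ?thesis
  proof eventually_elim
    case (elim q)
    show ?case
    proof
      assume q: "q \<in> box (g (transverse \<xi>) l, -1) (g (transverse \<xi>) (Suc l), 1)"
      have ind: "indicator ?S (pt \<xi> t q) = (indicator {g \<xi> k<..<g \<xi> (Suc k)} t :: real)" for t
        using pt_in_slab_cell[OF \<xi>] q by (simp add: indicator_def)
      have "(\<lambda>t. u (pt \<xi> t q)) absolutely_integrable_on {g \<xi> k<..<g \<xi> (Suc k)}"
        using elim unfolding absolutely_integrable_componentwise_iff[where f = "\<lambda>t. u (pt \<xi> t q)"]
        by (simp add: ind set_integrable_def)
      then show "(\<lambda>t. u (pt \<xi> t q)) absolutely_integrable_on {g \<xi> k..g \<xi> (Suc k)}"
        unfolding absolutely_integrable_on_Icc_iff_Ioo .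
    qed
  qed
qed

lemma Face_strips:
  assumes gr: "grid n h"
  shows "AE q in lebesgue. q \<in> Face \<longrightarrow> (\<exists>l<n. q \<in> box (h l, -1) (h (Suc l), 1))"
proof -
  let ?N = "(\<Union>i\<in>{..n}. {q :: real \<times> real. q \<bullet> (1, 0) = h i}) \<union> {q. q \<bullet> (0, 1) = -1} \<union> {q. q \<bullet> (0, 1) = 1}"
  have "negligible ?N"
    by (intro negligible_Un negligible_Union)
      (auto intro!: negligible_standard_hyperplane simp: Basis_prod_def)
  then have "AE q in lebesgue. q \<notin> ?N"
    by (metis AE_not_in negligible_iff_null_sets)
  then show ?thesis
  proof eventually_elim
    case (elim q)
    show ?case
    proof
      assume q: "q \<in> Face"
      obtain x z where xz: "q = (x, z)" by (cases q)
      have "x \<in> {-1..1}" "-1 \<le> z" "z \<le> 1"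
        using q by (simp_all add: Face_def mem_box Basis_prod_def zero_prod_def xz)
      moreover have "\<forall>i\<le>n. x \<noteq> h i" "z \<noteq> -1" "z \<noteq> 1"
        using elim by (simp_all add: xz)
      ultimately obtain l where "l < n" "h l < x" "x < h (Suc l)" "-1 < z" "z < 1"
        using grid_cover[OF gr, of x] by (metis order_le_less)
      then show "\<exists>l<n. q \<in> box (h l, -1) (h (Suc l), 1)"
        by (intro exI[of _ l]) (simp add: mem_box Basis_prod_def zero_prod_def xz)
    qed
  qed
qed

text \<open>
  Almost every line in direction \<open>\<xi>\<close> runs through one column of cells. There the absolute continuity,
  the integrability of the derivative and the interface conditions hold on all cells at once,
  because there are only finitely many of them.
\<close>
lemma line_flux:
  assumes \<xi>: "\<xi> \<in> {1, 2}" and gr: "\<forall>\<xi>\<in>{1, 2}. grid (N \<xi>) (g \<xi>)"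
    and reg: "\<And>k l. k < N \<xi> \<Longrightarrow> l < N (transverse \<xi>) \<Longrightarrow> H1_on (slab_cell \<xi> g k l) Q DQ"
    and ifc: "interface_conditions N g Q"
  shows "AE q in lebesgue. q \<in> Face \<longrightarrow>
    ((\<lambda>t. Q (pt \<xi> t q) \<bullet> (cmat (Amat \<xi>) *v DQ \<xi> (pt \<xi> t q))) has_integral
      vel (trace_minus \<xi> 1 Q q) \<bullet> traction \<xi> (trace_minus \<xi> 1 Q q)
      - vel (trace_plus \<xi> (-1) Q q) \<bullet> traction \<xi> (trace_plus \<xi> (-1) Q q)) {-1..1}"
proof -
  let ?\<zeta> = "transverse \<xi>"
  let ?R = "\<lambda>l. box (g ?\<zeta> l, -1) (g ?\<zeta> (Suc l), 1) :: (real \<times> real) set"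
  have \<zeta>: "?\<zeta> \<in> {1, 2}" by (simp add: transverse_def)
  have "AE q in lebesgue. \<forall>k\<in>{..<N \<xi>}. \<forall>l\<in>{..<N ?\<zeta>}. q \<in> ?R l \<longrightarrow>
      (\<lambda>t. DQ \<xi> (pt \<xi> t q)) absolutely_integrable_on {g \<xi> k..g \<xi> (Suc k)}"
  proof (intro AE_finite_allI finite_lessThan L2_on_line_integrable[OF \<xi>])
    fix k l assume "k \<in> {..<N \<xi>}" "l \<in> {..<N ?\<zeta>}"
    then show "L2_on (slab_cell \<xi> g k l) (DQ \<xi>)" using reg unfolding H1_on_def by simp
  qed
  moreover have "AE q in lebesgue. \<forall>k\<in>{..<N \<xi>}. \<forall>l\<in>{..<N ?\<zeta>}.
      \<forall>r t. r \<le> t \<and> (\<forall>\<tau>\<in>{r..t}. pt \<xi> \<tau> q \<in> slab_cell \<xi> g k l) \<longrightarrow>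
        set_integrable lebesgue {r..t} (\<lambda>\<tau>. DQ \<xi> (pt \<xi> \<tau> q)) \<and>
        Q (pt \<xi> t q) - Q (pt \<xi> r q) = (LINT \<tau>:{r..t}|lebesgue. DQ \<xi> (pt \<xi> \<tau> q))"
  proof (intro AE_finite_allI finite_lessThan)
    fix k l assume "k \<in> {..<N \<xi>}" "l \<in> {..<N ?\<zeta>}"
    then have "acl_partial \<xi> (slab_cell \<xi> g k l) Q (DQ \<xi>)"
      using reg unfolding H1_on_def by simp
    then show "AE q in lebesgue. \<forall>r t. r \<le> t \<and> (\<forall>\<tau>\<in>{r..t}. pt \<xi> \<tau> q \<in> slab_cell \<xi> g k l) \<longrightarrow>
        set_integrable lebesgue {r..t} (\<lambda>\<tau>. DQ \<xi> (pt \<xi> \<tau> q)) \<and>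
        Q (pt \<xi> t q) - Q (pt \<xi> r q) = (LINT \<tau>:{r..t}|lebesgue. DQ \<xi> (pt \<xi> \<tau> q))"
      unfolding acl_partial_def .
  qed
  moreover have "AE q in lebesgue. \<forall>i\<in>{1..<N \<xi>}. q \<in> Face \<longrightarrow>
        traction \<xi> (trace_plus \<xi> (g \<xi> i) Q q) = traction \<xi> (trace_minus \<xi> (g \<xi> i) Q q) \<and>
        vel (trace_plus \<xi> (g \<xi> i) Q q) - vel (trace_minus \<xi> (g \<xi> i) Q q) = 0"
    using ifc[unfolded interface_conditions_def, THEN bspec[of _ _ \<xi>, OF _ \<xi>]]
    by (intro AE_finite_allI finite_atLeastLessThan) (rule bspec)
  moreover have "AE q in lebesgue. q \<in> Face \<longrightarrow> (\<exists>l<N ?\<zeta>. q \<in> ?R l)"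
    using gr \<zeta> by (intro Face_strips) blast
  ultimately show ?thesis
  proof eventually_elim
    case (elim q)
    note int = elim(1) and acl = elim(2) and jump = elim(3) and strip = elim(4)
    show ?case
    proof
      assume q: "q \<in> Face"
      then obtain l where l: "l < N ?\<zeta>" "q \<in> ?R l" using strip by blast
      let ?u = "\<lambda>t. Q (pt \<xi> t q)" and ?w = "\<lambda>t. DQ \<xi> (pt \<xi> t q)"
      let ?B = "\<lambda>x y. x \<bullet> (cmat (Amat \<xi>) *v y)"
      have "((\<lambda>t. ?B (?u t) (?w t)) has_integral
           (?B (Lim (at_left 1) ?u) (Lim (at_left 1) ?u)
             - ?B (Lim (at_right (-1)) ?u) (Lim (at_right (-1)) ?u)) / 2) {-1..1}"
      proof (rule column_flux[OF bounded_bilinear_form form_symmetric[OF transpose_Amat]])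
        show "grid (N \<xi>) (g \<xi>)" using gr \<xi> by blast
        show "?w absolutely_integrable_on {g \<xi> i..g \<xi> (Suc i)}" if "i < N \<xi>" for i
          using int that l by blast
        show "?u t - ?u r = integral {r..t} ?w"
          if "i < N \<xi>" "g \<xi> i < r" "r \<le> t" "t < g \<xi> (Suc i)" for i r t
        proof -
          have "\<forall>\<tau>\<in>{r..t}. pt \<xi> \<tau> q \<in> slab_cell \<xi> g i l"
            using that l(2) pt_in_slab_cell[OF \<xi>] by auto
          with that l(1) have "set_integrable lebesgue {r..t} ?w"
              "?u t - ?u r = (LINT \<tau>:{r..t}|lebesgue. ?w \<tau>)"
            using acl[THEN bspec[of _ _ i], THEN bspec[of _ _ l], THEN spec[of _ r], THEN spec[of _ t]]
            by simp_all
          then show ?thesis by (simp only: set_lebesgue_integral_eq_integral(2))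
        qed
        show "?B (Lim (at_right (g \<xi> i)) ?u) (Lim (at_right (g \<xi> i)) ?u)
          = ?B (Lim (at_left (g \<xi> i)) ?u) (Lim (at_left (g \<xi> i)) ?u)" if "i \<in> {1..<N \<xi>}" for i
          using jump that q unfolding Amat_form trace_plus_def trace_minus_def by simp
      qed
      moreover have "(?B x x - ?B y y) / 2 = vel x \<bullet> traction \<xi> x - vel y \<bullet> traction \<xi> y" for x y
        unfolding Amat_form by simp
      ultimately show "((\<lambda>t. ?B (?u t) (?w t)) has_integral
          vel (trace_minus \<xi> 1 Q q) \<bullet> traction \<xi> (trace_minus \<xi> 1 Q q)
          - vel (trace_plus \<xi> (-1) Q q) \<bullet> traction \<xi> (trace_plus \<xi> (-1) Q q)) {-1..1}"
        unfolding trace_plus_def trace_minus_def by (simp only:)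
    qed
  qed
qed

text \<open>
  The divergence identity: integrating line balances over the face gives the volume integral. The
  measurability of \<open>\<Phi>\<close> comes for free, as it agrees almost everywhere with the line integrals.
\<close>
lemma flux_integral:
  fixes f :: "pos \<Rightarrow> real"
  assumes \<xi>: "\<xi> \<in> {1, 2}"
    and f: "f absolutely_integrable_on Omega"
    and line: "AE q in lebesgue. q \<in> Face \<longrightarrow> ((\<lambda>t. f (pt \<xi> t q)) has_integral \<Phi> q) {-1..1}"
  shows "integral Omega f = (LINT q:Face|lebesgue. \<Phi> q)"
proof -
  let ?f = "\<lambda>p. indicator Omega p *\<^sub>R f p"
  have i: "integrable lebesgue ?f" using f by (simp add: set_integrable_def)
  note Fub = lebesgue_Fubini_pt[OF i, of \<xi>]
  have e: "AE q in lebesgue. (LINT t|lebesgue. ?f (pt \<xi> t q)) = indicator Face q *\<^sub>R \<Phi> q"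
    using Fub(1) line
  proof eventually_elim
    case (elim q)
    show ?case
    proof (cases "q \<in> Face")
      case False
      then have "(\<lambda>t. ?f (pt \<xi> t q)) = (\<lambda>_. 0)" using pt_in_Omega[OF \<xi>] by auto
      then show ?thesis using False by (simp only:) simp
    next
      case True
      have ff: "?f (pt \<xi> t q) = indicator {-1..1} t *\<^sub>R f (pt \<xi> t q)" for t
        using True pt_in_Omega[OF \<xi>, of t q] by (simp add: indicator_def)
      have "(\<lambda>t. f (pt \<xi> t q)) absolutely_integrable_on {-1..1}"
        using elim(1) unfolding ff set_integrable_def .
      then have "(LINT t|lebesgue. ?f (pt \<xi> t q)) = integral {-1..1} (\<lambda>t. f (pt \<xi> t q))"
        unfolding ff by (simp add: set_lebesgue_integral_eq_integral(2)[symmetric] set_lebesgue_integral_def)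
      also have "\<dots> = \<Phi> q" using elim(2) True by (simp add: integral_unique)
      finally show ?thesis using True by simp
    qed
  qed
  have "integral Omega f = (LINT p|lebesgue. ?f p)"
    using set_lebesgue_integral_eq_integral(2)[OF f] by (simp add: set_lebesgue_integral_def)
  also have "\<dots> = (LINT q|lebesgue. LINT t|lebesgue. ?f (pt \<xi> t q))" by (rule Fub(3))
  also have "\<dots> = (LINT q|lebesgue. indicator Face q *\<^sub>R \<Phi> q)"
    using borel_measurable_AE[OF Fub(2) e] e by (intro integral_cong_AE Fub(2))
  finally show ?thesis by (simp add: set_lebesgue_integral_def)
qed

section \<open>The energy balance on the cells and its weighted norms\<close>

text \<open>
  The damping contributes $\delta\, \mathrm{Re}\,(s / (s + \alpha))$, and
  $\mathrm{Re}\,(s\,\overline{(s + \alpha)}) = |s|^2 + \alpha\, \mathrm{Re}\, s \ge 0$.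
\<close>
lemma Re_pml_stretch:
  assumes "\<delta> \<ge> 0" "\<alpha> \<ge> 0" "a > 0" "Re s \<ge> a"
  shows "Re (s * (1 + of_real \<delta> / (s + of_real \<alpha>))) \<ge> a"
proof -
  let ?w = "s + of_real \<alpha>"
  have "Re (s / ?w) = Re (s * cnj ?w) / (cmod ?w)\<^sup>2"
    by (subst complex_div_cnj) (simp only: of_real_power[symmetric] Re_divide_of_real)
  moreover have "Re (s * cnj ?w) = (Re s)\<^sup>2 + (Im s)\<^sup>2 + \<alpha> * Re s"
    by (simp add: algebra_simps power2_eq_square)
  ultimately have "Re (s / ?w) \<ge> 0" using assms by simp
  then have "\<delta> * Re (s / ?w) \<ge> 0" using assms by simp
  moreover have "s * (1 + of_real \<delta> / ?w) = s + of_real \<delta> * (s / ?w)"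
    by (simp add: distrib_left mult.commute)
  then have "Re (s * (1 + of_real \<delta> / ?w)) = Re s + \<delta> * Re (s / ?w)"
    by (simp only: plus_complex.sel Re_complex_of_real times_complex.sel Im_complex_of_real mult_zero_left diff_zero)
  ultimately show ?thesis using assms by linarith
qed

lemma absolutely_integrable_AE_cong:
  fixes f h :: "pos \<Rightarrow> real"
  assumes f: "f absolutely_integrable_on S" and ae: "AE p in lebesgue. p \<in> S \<longrightarrow> h p = f p"
  shows "h absolutely_integrable_on S" "integral S h = integral S f"
proof -
  obtain N where N: "N \<in> null_sets lebesgue" "\<And>p. p \<notin> N \<Longrightarrow> p \<in> S \<Longrightarrow> h p = f p"
    using ae unfolding completion.AE_iff_null_sets by auto
  have n: "negligible N" using N(1) by (simp add: negligible_iff_null_sets)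
  have e: "h p = f p" if "p \<in> S - N" for p using N(2) that by blast
  show "h absolutely_integrable_on S"
    using absolutely_integrable_spike[OF f n e] .
  show "integral S h = integral S f"
    by (rule integral_spike[OF n]) (use e in simp)
qed

lemma Cell_subset_Omega:
  assumes "grid n (g 1)" "grid m (g 2)" "i < n" "j < m"
  shows "Cell g i j \<subseteq> Omega"
proof
  have b: "-1 \<le> h k \<and> h (Suc k) \<le> 1" if "grid r h" "k < r" for r h k
    using that grid_less[of r h 0 k] grid_less[of r h "Suc k" r]
    by (cases "k = 0"; cases "Suc k = r") (auto simp: grid_def)
  fix p assume "p \<in> Cell g i j"
  then show "p \<in> Omega"
    using b[OF assms(1,3)] b[OF assms(2,4)]
    by (cases p) (simp add: Cell_def Omega_def mem_box Basis_prod_def zero_prod_def)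
qed

lemma Omega_cells:
  assumes gr: "grid n (g 1)" "grid m (g 2)"
  shows "AE p in lebesgue. p \<in> Omega \<longrightarrow> (\<exists>i<n. \<exists>j<m. p \<in> Cell g i j)"
proof -
  let ?N = "(\<Union>i\<in>{..n}. {p :: pos. p \<bullet> (1, 0, 0) = g 1 i}) \<union> (\<Union>i\<in>{..m}. {p. p \<bullet> (0, 1, 0) = g 2 i})
      \<union> ({p. p \<bullet> (0, 0, 1) = -1} \<union> {p. p \<bullet> (0, 0, 1) = 1})"
  have "negligible ?N"
    by (intro negligible_Un negligible_Union)
      (auto intro!: negligible_standard_hyperplane simp: Basis_prod_def zero_prod_def)
  then have "AE p in lebesgue. p \<notin> ?N"
    by (metis AE_not_in negligible_iff_null_sets)
  then show ?thesis
  proof eventually_elim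
    case (elim p)
    show ?case
    proof
      assume p: "p \<in> Omega"
      obtain x y z where xyz: "p = (x, y, z)" by (cases p)
      have "x \<in> {-1..1}" "y \<in> {-1..1}" "-1 \<le> z" "z \<le> 1"
        using p by (simp_all add: Omega_def mem_box Basis_prod_def zero_prod_def xyz)
      moreover have "\<forall>i\<le>n. x \<noteq> g 1 i" "\<forall>i\<le>m. y \<noteq> g 2 i" "z \<noteq> -1" "z \<noteq> 1"
        using elim by (simp_all add: xyz)
      ultimately obtain i j where "i < n" "g 1 i < x" "x < g 1 (Suc i)"
          "j < m" "g 2 j < y" "y < g 2 (Suc j)" "-1 < z" "z < 1"
        using grid_cover[OF gr(1), of x] grid_cover[OF gr(2), of y] by (metis order_le_less)
      then show "\<exists>i<n. \<exists>j<m. p \<in> Cell g i j"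
        by (intro exI[of _ i] exI[of _ j] conjI)
          (simp_all add: Cell_def mem_box Basis_prod_def zero_prod_def xyz)
    qed
  qed
qed

lemma AE_Omega_if_AE_cells:
  assumes gr: "grid n (g 1)" "grid m (g 2)"
    and P: "\<And>i j. i < n \<Longrightarrow> j < m \<Longrightarrow> AE p in lebesgue. p \<in> Cell g i j \<longrightarrow> R p"
  shows "AE p in lebesgue. p \<in> Omega \<longrightarrow> R p"
proof -
  have "AE p in lebesgue. \<forall>i\<in>{..<n}. \<forall>j\<in>{..<m}. p \<in> Cell g i j \<longrightarrow> R p"
    by (intro AE_finite_allI finite_lessThan) (use P in simp)
  with Omega_cells[OF gr] show ?thesis
    by eventually_elim blast
qed

text \<open>
  The cells are open and leave out the grid planes and the faces of the cube, a null set.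
\<close>
lemma absolutely_integrable_on_Omega_if_cells:
  fixes f :: "pos \<Rightarrow> real"
  assumes gr: "grid n (g 1)" "grid m (g 2)"
    and f: "\<And>i j. i < n \<Longrightarrow> j < m \<Longrightarrow> f absolutely_integrable_on Cell g i j"
  shows "f absolutely_integrable_on Omega"
proof -
  let ?I = "{..<n} \<times> {..<m}"
  let ?U = "\<Union>x\<in>?I. Cell g (fst x) (snd x)"
  have meas: "Cell g i j \<in> sets lebesgue" for i j
    using Cell_lmeasurable(1) by (rule fmeasurableD)
  have fin: "finite ?I" by simp
  have U: "f absolutely_integrable_on ?U"
  proof (rule set_integrable_UN[OF fin])
    show "f absolutely_integrable_on Cell g (fst x) (snd x)" if "x \<in> ?I" for x
      by (rule f) (use that in \<open>simp_all add: mem_Times_iff\<close>)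
  qed (rule meas)
  have sub: "?U \<subseteq> Omega" using Cell_subset_Omega[OF gr] by fastforce
  obtain N where N: "N \<in> null_sets lebesgue" "\<And>p. p \<notin> N \<Longrightarrow> p \<in> Omega \<Longrightarrow> \<exists>i<n. \<exists>j<m. p \<in> Cell g i j"
    using Omega_cells[OF gr] unfolding completion.AE_iff_null_sets by auto
  have "Omega - ?U \<subseteq> N" using N(2) by fastforce
  then have neg: "negligible (Omega - ?U)"
    using N(1) negligible_subset[of N] by (simp only: negligible_iff_null_sets)
  have "{x \<in> ?U - Omega. f x \<noteq> 0} = {}" using sub by blast
  then have n1: "negligible {x \<in> ?U - Omega. f x \<noteq> 0}" by (simp only: negligible_empty)
  have n2: "negligible {x \<in> Omega - ?U. f x \<noteq> 0}"
    by (rule negligible_subset[OF neg]) blast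
  show ?thesis using absolutely_integrable_spike_set[OF U n1 n2] .
qed

lemma L2_on_subset:
  assumes u: "L2_on T u" and "S \<in> sets lebesgue" "T \<in> sets lebesgue" "S \<subseteq> T"
  shows "L2_on S u"
proof (rule L2_onI)
  show "u \<in> borel_measurable (lebesgue_on S)"
    by (rule measurable_restrict_mono[OF L2_on_measurable[OF u assms(3)] assms(4)])
  show "(\<lambda>p. u p \<bullet> u p) absolutely_integrable_on S"
    by (rule set_integrable_subset[OF L2_on_bilinear[OF bounded_bilinear_inner assms(3) u u] assms(2,4)])
qed (fact assms(2))

lemma L2_on_scale: "S \<in> sets lebesgue \<Longrightarrow> L2_on S u \<Longrightarrow> L2_on S (\<lambda>p. c *s u p)"
  by (rule L2_on_linear)
    (auto intro!: linearI simp: vec_eq_iff algebra_simps)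

text \<open>
  The source carries a factor \<open>P\<close>, which the equation removes again. What remains is a combination
  of the given square-integrable fields, in which the material parameters do not occur.
\<close>
lemma inverse_source:
  assumes "sym_pos_def (P p)"
  shows "cmat (matrix_inv (P p)) *v source P d \<alpha> s FQ Fw p =
    S_pml d \<alpha> s p *s FQ p + ((- of_real (d p) / (s + of_real \<alpha>)) *s Fw 1 p
      + (- of_real (d p) / (s + of_real \<alpha>)) *s Fw 2 p)"
  unfolding source_def cmat_mult sym_pos_def_inverse(1)[OF assms] cmat_one
  by (simp add: vec_eq_iff)

text \<open>
  On a cell the stretching factor is a constant \<open>c\<close>, so the equation expresses $P^{-1} Q$ as a linear
  combination of square-integrable fields. Hence the energy density is integrable, although no
  bounds on the material parameters are assumed. The energy balance is the equation tested with \<open>Q\<close>.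
\<close>
lemma cell_energy:
  fixes P :: "pos \<Rightarrow> real ^ (3 + 6) ^ (3 + 6)"
  defines "e \<equiv> \<lambda>p. cmat (matrix_inv (P p))"
  assumes B: "B \<in> sets lebesgue" and spd: "\<And>p. p \<in> B \<Longrightarrow> sym_pos_def (P p)"
    and d: "d constant_on B"
    and L2: "L2_on B Q" "\<And>\<xi>. L2_on B (DQ \<xi>)" "L2_on B FQ" "L2_on B (Fw 1)" "L2_on B (Fw 2)"
    and nz: "\<And>p. p \<in> B \<Longrightarrow> s * S_pml d \<alpha> s p \<noteq> 0"
    and eq: "pml_equation_on B P d \<alpha> s Q DQ (source P d \<alpha> s FQ Fw)"
  shows "(\<lambda>p. Q p \<bullet> (e p *v Q p)) absolutely_integrable_on B"
    and "(\<lambda>p. Q p \<bullet> (e p *v source P d \<alpha> s FQ Fw p)) absolutely_integrable_on B"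
    and "AE p in lebesgue. p \<in> B \<longrightarrow> Re (s * S_pml d \<alpha> s p) * (Q p \<bullet> (e p *v Q p)) =
      (Q p \<bullet> (cmat (Amat 1) *v DQ 1 p) + Q p \<bullet> (cmat (Amat 2) *v DQ 2 p))
        + Q p \<bullet> (e p *v source P d \<alpha> s FQ Fw p)"
proof -
  let ?F = "source P d \<alpha> s FQ Fw"
  obtain \<delta> where \<delta>: "\<And>p. p \<in> B \<Longrightarrow> d p = \<delta>" using d unfolding constant_on_def by blast
  define c where "c = 1 + of_real \<delta> / (s + of_real \<alpha>)"
  define \<kappa> where "\<kappa> = - of_real \<delta> / (s + of_real \<alpha>)"
  have S: "S_pml d \<alpha> s p = c" if "p \<in> B" for p
    using \<delta>[OF that] by (simp add: S_pml_def c_def)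
  define G where "G = (\<lambda>p. c *s FQ p + (\<kappa> *s Fw 1 p + \<kappa> *s Fw 2 p))"
  have G: "e p *v ?F p = G p" if "p \<in> B" for p
    unfolding e_def inverse_source[where P = P and p = p, OF spd[OF that]] S[OF that] \<delta>[OF that] G_def \<kappa>_def ..
  have GL2: "L2_on B G"
    unfolding G_def by (intro L2_on_add L2_on_scale B L2)
  \<comment> \<open>Where the equation holds, this is $P^{-1} Q$.\<close>
  define W where "W = (\<lambda>p. inverse (s * c) *s ((cmat (Amat 1) *v DQ 1 p + cmat (Amat 2) *v DQ 2 p) + G p))"
  have WL2: "L2_on B W"
    unfolding W_def by (intro L2_on_scale L2_on_add L2_on_linear[OF linear_cmat] B L2 GL2)
  have eq': "AE p in lebesgue. p \<in> B \<longrightarrow>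
      (s * c) *s (e p *v Q p) = (cmat (Amat 1) *v DQ 1 p + cmat (Amat 2) *v DQ 2 p) + G p"
    using eq unfolding pml_equation_on_def
  proof eventually_elim
    case (elim p)
    show ?case
    proof
      assume p: "p \<in> B"
      show "(s * c) *s (e p *v Q p) = (cmat (Amat 1) *v DQ 1 p + cmat (Amat 2) *v DQ 2 p) + G p"
        using elim p G[OF p] S[OF p] unfolding e_def by simp
    qed
  qed
  have W: "AE p in lebesgue. p \<in> B \<longrightarrow> Q p \<bullet> (e p *v Q p) = Q p \<bullet> W p"
    using eq'
  proof eventually_elim
    case (elim p)
    show ?case
    proof
      assume p: "p \<in> B"
      have sc: "s * c \<noteq> 0" using nz[OF p] S[OF p] by simp
      then have "e p *v Q p = inverse (s * c) *s ((s * c) *s (e p *v Q p))"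
        by (simp only: vector_smult_assoc left_inverse[OF sc] vector_smult_lid)
      then show "Q p \<bullet> (e p *v Q p) = Q p \<bullet> W p" using elim p by (simp add: W_def)
    qed
  qed
  show "(\<lambda>p. Q p \<bullet> (e p *v Q p)) absolutely_integrable_on B"
    by (rule absolutely_integrable_AE_cong(1)[OF L2_on_bilinear[OF bounded_bilinear_inner B L2(1) WL2] W])
  have "AE p in lebesgue. p \<in> B \<longrightarrow> Q p \<bullet> (e p *v ?F p) = Q p \<bullet> G p"
    using G by (intro AE_I2) simp
  then show "(\<lambda>p. Q p \<bullet> (e p *v ?F p)) absolutely_integrable_on B"
    by (rule absolutely_integrable_AE_cong(1)[OF L2_on_bilinear[OF bounded_bilinear_inner B L2(1) GL2]])
  show "AE p in lebesgue. p \<in> B \<longrightarrow> Re (s * S_pml d \<alpha> s p) * (Q p \<bullet> (e p *v Q p)) =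
      (Q p \<bullet> (cmat (Amat 1) *v DQ 1 p) + Q p \<bullet> (cmat (Amat 2) *v DQ 2 p))
        + Q p \<bullet> (e p *v ?F p)"
    using eq'
  proof eventually_elim
    case (elim p)
    show ?case
    proof
      assume p: "p \<in> B"
      have "Q p \<bullet> ((s * c) *s (e p *v Q p)) = Re (s * c) * (Q p \<bullet> (e p *v Q p))"
      proof -
        have "hdot (Q p) ((s * c) *s (e p *v Q p)) = (s * c) * hdot (Q p) (e p *v Q p)"
          by (simp add: hdot_def sum_distrib_left mult_ac)
        also have "\<dots> = (s * c) * of_real (Q p \<bullet> (e p *v Q p))"
          unfolding e_def hdot_cmat_real[OF sym_pos_def_inverse(3)[OF spd[OF p]]] ..
        finally show ?thesis by (simp add: Re_hdot[symmetric])
      qed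
      with elim p show "Re (s * S_pml d \<alpha> s p) * (Q p \<bullet> (e p *v Q p)) =
          (Q p \<bullet> (cmat (Amat 1) *v DQ 1 p) + Q p \<bullet> (cmat (Amat 2) *v DQ 2 p)) + Q p \<bullet> (e p *v ?F p)"
        by (simp add: S[OF p] G[OF p] inner_add_right)
    qed
  qed
qed

lemma Omega_sets: "Omega \<in> sets lebesgue"
  by (simp add: Omega_def)

text \<open>
  The integrand of the weighted inner product of \<open>u\<close> with itself is real and nonnegative, so the
  definition of the norm by a square root and a real part loses nothing.
\<close>
lemma norm_P_square:
  assumes spd: "\<And>p. p \<in> Omega \<Longrightarrow> sym_pos_def (P p)"
  shows "(norm_P P u)\<^sup>2 = (LINT p:Omega|lebesgue. u p \<bullet> (cmat (matrix_inv (P p)) *v u p)) / 2"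
    and "norm_P P u \<ge> 0"
    and "0 \<le> (LINT p:Omega|lebesgue. u p \<bullet> (cmat (matrix_inv (P p)) *v u p))"
proof -
  let ?e = "\<lambda>p. u p \<bullet> (cmat (matrix_inv (P p)) *v u p)"
  have "inner_P P u u = (LINT p:Omega|lebesgue. of_real (1/2 * ?e p))"
    unfolding inner_P_def
    by (rule set_lebesgue_integral_cong[OF Omega_sets])
      (simp add: hdot_cmat_real sym_pos_def_inverse(3) spd)
  then have i: "Re (inner_P P u u) = (LINT p:Omega|lebesgue. ?e p) / 2"
    unfolding set_integral_complex_of_real set_integral_mult_right
    by (simp only: Re_complex_of_real)
  have "0 \<le> ?e p" if "p \<in> Omega" for p
    by (rule form_nonneg[OF sym_pos_def_inverse(4)[OF spd[OF that]]])
  then have "AE p in lebesgue. 0 \<le> indicator Omega p *\<^sub>R ?e p"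
    by (intro AE_I2) (simp add: indicator_def)
  then show n: "0 \<le> (LINT p:Omega|lebesgue. ?e p)"
    unfolding set_lebesgue_integral_def by (rule integral_nonneg_AE)
  show "(norm_P P u)\<^sup>2 = (LINT p:Omega|lebesgue. ?e p) / 2" "norm_P P u \<ge> 0"
    using n by (simp_all add: norm_P_def i)
qed

text \<open>
  If both numbers are positive, the best weight is $t = \sqrt{b / a}$. If one vanishes, the optimum is
  only approached as \<open>t\<close> tends to infinity or to $0$, hence the slack \<open>\<epsilon>\<close>.
\<close>
lemma le_sqrt_mult_if_le_weighted_mean:
  fixes X a b :: real
  assumes "a \<ge> 0" "b \<ge> 0" and le: "\<And>t. t > 0 \<Longrightarrow> X \<le> (t * a + b / t) / 2"
  shows "X \<le> sqrt a * sqrt b"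
proof (rule field_le_epsilon)
  fix \<epsilon> :: real assume \<epsilon>: "\<epsilon> > 0"
  define r where "r = sqrt a"
  define q where "q = sqrt b"
  have r: "r \<ge> 0" "a = r\<^sup>2" and q: "q \<ge> 0" "b = q\<^sup>2" using assms by (simp_all add: r_def q_def)
  show "X \<le> sqrt a * sqrt b + \<epsilon>"
  proof (cases "r = 0")
    case True
    have "X \<le> b / ((b + 1) / \<epsilon>) / 2" using le[of "(b + 1) / \<epsilon>"] \<epsilon> assms True r by simp
    also have "\<dots> \<le> \<epsilon>" using \<epsilon> assms by (simp add: field_simps)
    finally show ?thesis using True by (simp add: r_def)
  next
    case False
    then have rp: "r > 0" using r by simp
    show ?thesis
    proof (cases "q = 0")
      case True
      have "X \<le> (\<epsilon> / a * a) / 2" using le[of "\<epsilon> / a"] \<epsilon> rp True q r by simp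
      also have "\<dots> \<le> \<epsilon>" using \<epsilon> rp r by simp
      finally show ?thesis using True by (simp add: q_def)
    next
      case False
      then have qp: "q > 0" using q by simp
      have "X \<le> (q / r * a + b / (q / r)) / 2" using le[of "q / r"] rp qp by simp
      also have "\<dots> = r * q" using rp qp by (simp add: r q power2_eq_square)
      finally show ?thesis using \<epsilon> by (simp add: r_def q_def)
    qed
  qed
qed

text \<open>
  Integrating the pointwise weighted inequality and optimising the weight afterwards yields
  Cauchy-Schwarz from integrability of the three densities alone. The factor $2$ compensates for the
  $\frac12$ in the weighted inner product.
\<close>
lemma norm_P_Cauchy_Schwarz:
  assumes spd: "\<And>p. p \<in> Omega \<Longrightarrow> sym_pos_def (P p)"
    and uu: "(\<lambda>p. u p \<bullet> (cmat (matrix_inv (P p)) *v u p)) absolutely_integrable_on Omega"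
    and uw: "(\<lambda>p. u p \<bullet> (cmat (matrix_inv (P p)) *v w p)) absolutely_integrable_on Omega"
    and ww: "(\<lambda>p. w p \<bullet> (cmat (matrix_inv (P p)) *v w p)) absolutely_integrable_on Omega"
  shows "(LINT p:Omega|lebesgue. u p \<bullet> (cmat (matrix_inv (P p)) *v w p)) \<le> 2 * (norm_P P u * norm_P P w)"
proof -
  let ?M = "\<lambda>p. cmat (matrix_inv (P p))"
  let ?I = "\<lambda>f. LINT p:Omega|lebesgue. f p"
  have pw: "u p \<bullet> (?M p *v w p) \<le> (t / 2) * (u p \<bullet> (?M p *v u p)) + (1 / (2 * t)) * (w p \<bullet> (?M p *v w p))"
    if t: "t > 0" and p: "p \<in> Omega" for t p
  proof -
    interpret bounded_bilinear "\<lambda>x y. x \<bullet> (?M p *v y)" by (rule bounded_bilinear_form)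
    \<comment> \<open>Nonnegativity of the form at $t u - w$, divided by $2 t$ at the end.\<close>
    have "0 \<le> (t *\<^sub>R u p - w p) \<bullet> (?M p *v (t *\<^sub>R u p - w p))"
      by (rule form_nonneg[OF sym_pos_def_inverse(4)[OF spd[OF p]]])
    also have "\<dots> = t * t * (u p \<bullet> (?M p *v u p)) - 2 * t * (u p \<bullet> (?M p *v w p)) + w p \<bullet> (?M p *v w p)"
      using form_symmetric[OF sym_pos_def_inverse(3)[OF spd[OF p]], of "w p" "u p"]
      by (simp add: diff_left diff_right scaleR_left scaleR_right algebra_simps)
    finally show ?thesis using t by (simp add: field_simps)
  qed
  have le: "?I (\<lambda>p. u p \<bullet> (?M p *v w p)) \<le>
      (t * ?I (\<lambda>p. u p \<bullet> (?M p *v u p)) + ?I (\<lambda>p. w p \<bullet> (?M p *v w p)) / t) / 2" if t: "t > 0" for t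
  proof -
    have i1: "set_integrable lebesgue Omega (\<lambda>p. (t / 2) * (u p \<bullet> (?M p *v u p)))"
      using uu by (rule set_integrable_mult_right)
    have i2: "set_integrable lebesgue Omega (\<lambda>p. (1 / (2 * t)) * (w p \<bullet> (?M p *v w p)))"
      using ww by (rule set_integrable_mult_right)
    have "?I (\<lambda>p. u p \<bullet> (?M p *v w p)) \<le>
        ?I (\<lambda>p. (t / 2) * (u p \<bullet> (?M p *v u p)) + (1 / (2 * t)) * (w p \<bullet> (?M p *v w p)))"
      by (rule set_integral_mono[OF uw set_integral_add(1)[OF i1 i2] pw[OF t]])
    also have "\<dots> = (t / 2) * ?I (\<lambda>p. u p \<bullet> (?M p *v u p)) + (1 / (2 * t)) * ?I (\<lambda>p. w p \<bullet> (?M p *v w p))"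
      unfolding set_integral_add(2)[OF i1 i2] set_integral_mult_right ..
    finally show ?thesis by (simp add: add_divide_distrib)
  qed
  note sq = norm_P_square[where P = P, OF spd]
  have "?I (\<lambda>p. u p \<bullet> (?M p *v w p)) \<le>
      sqrt (?I (\<lambda>p. u p \<bullet> (?M p *v u p))) * sqrt (?I (\<lambda>p. w p \<bullet> (?M p *v w p)))"
    by (rule le_sqrt_mult_if_le_weighted_mean[OF sq(3) sq(3) le])
  also have "?I (\<lambda>p. u p \<bullet> (?M p *v u p)) = 2 * (norm_P P u)\<^sup>2" using sq(1)[of u] by simp
  also have "?I (\<lambda>p. w p \<bullet> (?M p *v w p)) = 2 * (norm_P P w)\<^sup>2" using sq(1)[of w] by simp
  also have "sqrt (2 * (norm_P P u)\<^sup>2) * sqrt (2 * (norm_P P w)\<^sup>2) = 2 * (norm_P P u * norm_P P w)"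
    using sq(2)[of u] sq(2)[of w] by (simp add: real_sqrt_mult)
  finally show ?thesis .
qed

definition boundary_flux :: "3 \<Rightarrow> (pos \<Rightarrow> state) \<Rightarrow> real \<times> real \<Rightarrow> real" where
  "boundary_flux \<xi> Q q = vel (trace_minus \<xi> 1 Q q) \<bullet> traction \<xi> (trace_minus \<xi> 1 Q q)
      - vel (trace_plus \<xi> (-1) Q q) \<bullet> traction \<xi> (trace_plus \<xi> (-1) Q q)"

lemma boundary_term_eq_flux:
  "boundary_term Q = of_real (\<Sum>\<xi>\<in>{1, 2}. LINT q:Face|lebesgue. boundary_flux \<xi> Q q)"
proof -
  have "(1/2) * (hdot x (cmat (Amat \<xi>) *v x) - hdot y (cmat (Amat \<xi>) *v y))
      = of_real (vel x \<bullet> traction \<xi> x - vel y \<bullet> traction \<xi> y)" for x y \<xi>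
    unfolding hdot_cmat_real[OF transpose_Amat] Amat_form by simp
  then show ?thesis
    unfolding boundary_term_def boundary_flux_def
    by (simp only: set_integral_complex_of_real of_real_sum)
qed

text \<open>
  The sign holds before integration, and component by component: the power $v_\eta T_\eta$ is
  nonnegative at the lower face and nonpositive at the upper one, where the boundary condition has
  the opposite sign.
\<close>
lemma boundary_flux_nonpos:
  assumes \<xi>: "\<xi> \<in> {1, 2}" and bc: "boundary_conditions Z \<gamma> Q"
    and Z: "\<And>\<eta> p. p \<in> Omega \<Longrightarrow> Z \<xi> \<eta> p > 0" and g: "\<forall>\<eta>. \<bar>\<gamma> \<eta>\<bar> \<le> 1"
  shows "(LINT q:Face|lebesgue. boundary_flux \<xi> Q q) \<le> 0"
proof -
  have "AE q in lebesgue. \<forall>\<eta>\<in>UNIV. q \<in> Face \<longrightarrow>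
      vel (trace_plus \<xi> (-1) Q q) $ \<eta> \<bullet> traction \<xi> (trace_plus \<xi> (-1) Q q) $ \<eta> \<ge> 0 \<and>
      vel (trace_minus \<xi> 1 Q q) $ \<eta> \<bullet> traction \<xi> (trace_minus \<xi> 1 Q q) $ \<eta> \<le> 0"
  proof (rule AE_finite_allI)
    fix \<eta> :: 3
    have bc': "AE q in lebesgue. q \<in> Face \<longrightarrow>
        of_real (Z \<xi> \<eta> (pt \<xi> (-1) q) / 2 * (1 - \<gamma> \<eta>)) * vel (trace_plus \<xi> (-1) Q q) $ \<eta>
          - of_real ((1 + \<gamma> \<eta>) / 2) * traction \<xi> (trace_plus \<xi> (-1) Q q) $ \<eta> = 0 \<and>
        of_real (Z \<xi> \<eta> (pt \<xi> 1 q) / 2 * (1 - \<gamma> \<eta>)) * vel (trace_minus \<xi> 1 Q q) $ \<eta>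
          + of_real ((1 + \<gamma> \<eta>) / 2) * traction \<xi> (trace_minus \<xi> 1 Q q) $ \<eta> = 0"
      using bc \<xi> unfolding boundary_conditions_def by blast
    show "AE q in lebesgue. q \<in> Face \<longrightarrow>
      vel (trace_plus \<xi> (-1) Q q) $ \<eta> \<bullet> traction \<xi> (trace_plus \<xi> (-1) Q q) $ \<eta> \<ge> 0 \<and>
      vel (trace_minus \<xi> 1 Q q) $ \<eta> \<bullet> traction \<xi> (trace_minus \<xi> 1 Q q) $ \<eta> \<le> 0"
      using bc'
    proof eventually_elim
      case (elim q)
      show ?case
      proof
        assume q: "q \<in> Face"
        have "Z \<xi> \<eta> (pt \<xi> (-1) q) > 0" "Z \<xi> \<eta> (pt \<xi> 1 q) > 0"
          using q by (simp_all add: Z pt_in_Omega[OF \<xi>])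
        moreover have "\<bar>\<gamma> \<eta>\<bar> \<le> 1" using g by blast
        ultimately show "vel (trace_plus \<xi> (-1) Q q) $ \<eta> \<bullet> traction \<xi> (trace_plus \<xi> (-1) Q q) $ \<eta> \<ge> 0 \<and>
            vel (trace_minus \<xi> 1 Q q) $ \<eta> \<bullet> traction \<xi> (trace_minus \<xi> 1 Q q) $ \<eta> \<le> 0"
          using elim q boundary_sign[of "Z \<xi> \<eta> (pt \<xi> (-1) q)" "\<gamma> \<eta>"]
            boundary_sign[of "Z \<xi> \<eta> (pt \<xi> 1 q)" "\<gamma> \<eta>" "vel (trace_minus \<xi> 1 Q q) $ \<eta>"
              "- traction \<xi> (trace_minus \<xi> 1 Q q) $ \<eta>"]
          by simp
      qed
    qed
  qed simp
  then have "AE q in lebesgue. 0 \<le> - (indicator Face q *\<^sub>R boundary_flux \<xi> Q q)"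
  proof eventually_elim
    case (elim q)
    show ?case
    proof (cases "q \<in> Face")
      case True
      have "vel (trace_plus \<xi> (-1) Q q) \<bullet> traction \<xi> (trace_plus \<xi> (-1) Q q) \<ge> 0"
        unfolding inner_vec_def using elim True by (intro sum_nonneg) simp
      moreover have "vel (trace_minus \<xi> 1 Q q) \<bullet> traction \<xi> (trace_minus \<xi> 1 Q q) \<le> 0"
        unfolding inner_vec_def using elim True by (intro sum_nonpos) simp
      ultimately show ?thesis using True by (simp add: boundary_flux_def)
    qed simp
  qed
  then have "0 \<le> (LINT q|lebesgue. - (indicator Face q *\<^sub>R boundary_flux \<xi> Q q))"
    by (rule integral_nonneg_AE)
  then show ?thesis by (simp add: set_lebesgue_integral_def)
qed

section \<open>The energy estimate\<close>

theorem theorem2: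
  fixes Q FQ :: "pos \<Rightarrow> state"
    and DQ Fw :: "3 \<Rightarrow> pos \<Rightarrow> state"
    and \<rho> cp cs d :: "pos \<Rightarrow> real"
    and C :: "pos \<Rightarrow> real ^ 6 ^ 6"
    and P :: "pos \<Rightarrow> real ^ (3 + 6) ^ (3 + 6)"
    and F :: "pos \<Rightarrow> state"
    and \<gamma> :: "3 \<Rightarrow> real"
    and N :: "3 \<Rightarrow> nat" and g :: "3 \<Rightarrow> nat \<Rightarrow> real"
    and \<alpha> a :: real and s :: complex
  defines "P \<equiv> \<lambda>p. Pmat (\<rho> p) (C p)"
    and "F \<equiv> source P d \<alpha> s FQ Fw"
  assumes material: "set_borel_measurable lebesgue Omega \<rho>" "set_borel_measurable lebesgue Omega C"
      "\<forall>p\<in>Omega. \<rho> p > 0 \<and> sym_pos_def (C p) \<and> cp p > 0 \<and> cs p > 0"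
    and gridded: "\<forall>\<xi>\<in>{1, 2}. grid (N \<xi>) (g \<xi>)"
    and damping: "\<forall>p\<in>Omega. d p \<ge> 0"
      "\<forall>i<N 1. \<forall>j<N 2. d constant_on Cell g i j"
    and "\<alpha> \<ge> 0"
    and z_independent: "z_indep Q" "z_indep FQ" "\<forall>\<xi>\<in>{1, 2}. z_indep (Fw \<xi>)"
    and sources: "L2_on Omega FQ" "\<forall>\<xi>\<in>{1, 2}. L2_on Omega (Fw \<xi>)" "finite_norm_P P F"
    and regular: "\<forall>i<N 1. \<forall>j<N 2. H1_on (Cell g i j) Q DQ"
    and equation: "\<forall>i<N 1. \<forall>j<N 2. pml_equation_on (Cell g i j) P d \<alpha> s Q DQ F"
    and "\<forall>\<eta>. \<bar>\<gamma> \<eta>\<bar> \<le> 1"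
    and "boundary_conditions (impedance \<rho> cp cs) \<gamma> Q"
    and "interface_conditions N g Q"
    and "a > 0" and "Re s \<ge> a"
  shows "(\<forall>p\<in>Omega. Re (s * S_pml d \<alpha> s p) \<ge> a) \<and>
    (norm_P P (\<lambda>p. sqrt (Re (s * S_pml d \<alpha> s p)) *\<^sub>R Q p))\<^sup>2
      \<le> norm_P P Q * norm_P P F + Re (boundary_term Q) / 2 \<and>
    boundary_term Q \<in> \<real> \<and> Re (boundary_term Q) \<le> 0"
proof -
  let ?S = "\<lambda>p. s * S_pml d \<alpha> s p"
  let ?M = "\<lambda>p. cmat (matrix_inv (P p))"
  let ?h = "\<lambda>\<xi> p. Q p \<bullet> (cmat (Amat \<xi>) *v DQ \<xi> p)"
  let ?I = "\<lambda>f. LINT p:Omega|lebesgue. f p"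
  let ?e = "\<lambda>p. Q p \<bullet> (?M p *v Q p)"
  let ?r = "\<lambda>p. Q p \<bullet> (?M p *v F p)"
  have gr: "grid (N 1) (g 1)" "grid (N 2) (g 2)" using gridded by simp_all
  have spd: "sym_pos_def (P p)" if "p \<in> Omega" for p
    unfolding P_def using material(3) that by (intro sym_pos_def_Pmat) simp_all
  have Re_S: "Re (?S p) \<ge> a" if "p \<in> Omega" for p
    unfolding S_pml_def using damping(1) that \<open>\<alpha> \<ge> 0\<close> \<open>a > 0\<close> \<open>Re s \<ge> a\<close>
    by (intro Re_pml_stretch) simp_all
  have cell_meas: "Cell g i j \<in> sets lebesgue" for i j
    using Cell_lmeasurable(1) by (rule fmeasurableD)
  have cell: "(\<lambda>p. ?e p) absolutely_integrable_on Cell g i j"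
      "(\<lambda>p. ?r p) absolutely_integrable_on Cell g i j"
      "AE p in lebesgue. p \<in> Cell g i j \<longrightarrow> Re (?S p) * ?e p = (?h 1 p + ?h 2 p) + ?r p"
      "(\<lambda>p. ?h \<xi> p) absolutely_integrable_on Cell g i j"
    if ij: "i < N 1" "j < N 2" for i j \<xi>
  proof -
    have sub: "Cell g i j \<subseteq> Omega" by (rule Cell_subset_Omega[OF gr ij])
    have spd': "sym_pos_def (P p)" if "p \<in> Cell g i j" for p using spd sub that by blast
    have nz: "?S p \<noteq> 0" if "p \<in> Cell g i j" for p
    proof -
      have "Re (?S p) > 0" using Re_S[of p] sub that \<open>a > 0\<close> by force
      then show ?thesis by (metis less_irrefl zero_complex.sel(1))
    qed
    have d': "d constant_on Cell g i j" using damping(2) ij by blast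
    have H: "H1_on (Cell g i j) Q DQ" using regular ij by blast
    have L2: "L2_on (Cell g i j) Q" "\<And>\<xi>. L2_on (Cell g i j) (DQ \<xi>)"
      using H unfolding H1_on_def by simp_all
    have src: "L2_on (Cell g i j) FQ" "L2_on (Cell g i j) (Fw 1)" "L2_on (Cell g i j) (Fw 2)"
      using sources(1,2) L2_on_subset[OF _ cell_meas Omega_sets sub] by simp_all
    have eq: "pml_equation_on (Cell g i j) P d \<alpha> s Q DQ (source P d \<alpha> s FQ Fw)"
      using equation ij unfolding F_def by blast
    note * = cell_energy[where P = P and Q = Q and DQ = DQ,
        OF cell_meas spd' d' L2 src nz eq, folded F_def]
    show "(\<lambda>p. ?e p) absolutely_integrable_on Cell g i j" by (rule *(1))
    show "(\<lambda>p. ?r p) absolutely_integrable_on Cell g i j" by (rule *(2))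
    show "AE p in lebesgue. p \<in> Cell g i j \<longrightarrow> Re (?S p) * ?e p = (?h 1 p + ?h 2 p) + ?r p"
      by (rule *(3))
    show "(\<lambda>p. ?h \<xi> p) absolutely_integrable_on Cell g i j"
      by (rule L2_on_bilinear[OF bounded_bilinear_form cell_meas L2])
  qed
  note on_Omega = absolutely_integrable_on_Omega_if_cells[OF gr]
  have e: "(\<lambda>p. ?e p) absolutely_integrable_on Omega" by (rule on_Omega[OF cell(1)])
  have r: "(\<lambda>p. ?r p) absolutely_integrable_on Omega" by (rule on_Omega[OF cell(2)])
  have h: "(\<lambda>p. ?h \<xi> p) absolutely_integrable_on Omega" for \<xi> by (rule on_Omega[OF cell(4)])
  have energy: "AE p in lebesgue. p \<in> Omega \<longrightarrow> Re (?S p) * ?e p = (?h 1 p + ?h 2 p) + ?r p"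
    by (rule AE_Omega_if_AE_cells[OF gr cell(3)])
  have hh: "(\<lambda>p. ?h 1 p + ?h 2 p) absolutely_integrable_on Omega"
    by (rule set_integral_add(1)[OF h h])
  have hhr: "(\<lambda>p. (?h 1 p + ?h 2 p) + ?r p) absolutely_integrable_on Omega"
    by (rule set_integral_add(1)[OF hh r])
  note Se = absolutely_integrable_AE_cong[OF hhr energy]
  have "?I (\<lambda>p. Re (?S p) * ?e p) = integral Omega (\<lambda>p. Re (?S p) * ?e p)"
    by (rule set_lebesgue_integral_eq_integral(2)[OF Se(1)])
  also have "\<dots> = integral Omega (\<lambda>p. (?h 1 p + ?h 2 p) + ?r p)" by (rule Se(2))
  also have "\<dots> = ?I (\<lambda>p. (?h 1 p + ?h 2 p) + ?r p)"
    by (rule set_lebesgue_integral_eq_integral(2)[OF hhr, symmetric])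
  also have "\<dots> = (?I (?h 1) + ?I (?h 2)) + ?I ?r"
    unfolding set_integral_add(2)[OF hh r] set_integral_add(2)[OF h h] ..
  finally have balance: "?I (\<lambda>p. Re (?S p) * ?e p) = (?I (?h 1) + ?I (?h 2)) + ?I ?r" .
  have flux: "?I (?h \<xi>) = (LINT q:Face|lebesgue. boundary_flux \<xi> Q q)" if \<xi>: "\<xi> \<in> {1, 2}" for \<xi>
  proof -
    have "H1_on (slab_cell \<xi> g k l) Q DQ" if "k < N \<xi>" "l < N (transverse \<xi>)" for k l
      using regular that \<xi> by (auto simp: slab_cell_def transverse_def)
    from line_flux[where N = N and g = g, OF \<xi> gridded this \<open>interface_conditions N g Q\<close>]
    have "integral Omega (?h \<xi>) = (LINT q:Face|lebesgue. boundary_flux \<xi> Q q)"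
      unfolding boundary_flux_def by (rule flux_integral[OF \<xi> h])
    then show ?thesis unfolding set_lebesgue_integral_eq_integral(2)[OF h] .
  qed
  have Re_BT: "Re (boundary_term Q) = ?I (?h 1) + ?I (?h 2)"
    unfolding boundary_term_eq_flux Re_complex_of_real by (simp add: flux)
  have "Re (boundary_term Q) \<le> 0"
  proof -
    have "(LINT q:Face|lebesgue. boundary_flux \<xi> Q q) \<le> 0" if "\<xi> \<in> {1, 2}" for \<xi>
    proof (rule boundary_flux_nonpos[OF that \<open>boundary_conditions (impedance \<rho> cp cs) \<gamma> Q\<close>])
      show "impedance \<rho> cp cs \<xi> \<eta> p > 0" if "p \<in> Omega" for \<eta> p
        using material(3) that by (simp add: impedance_def)
    qed (fact \<open>\<forall>\<eta>. \<bar>\<gamma> \<eta>\<bar> \<le> 1\<close>)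
    then show ?thesis unfolding boundary_term_eq_flux Re_complex_of_real by (rule sum_nonpos)
  qed
  moreover have "boundary_term Q \<in> \<real>"
    unfolding boundary_term_eq_flux by (rule Reals_of_real)
  moreover have "(norm_P P (\<lambda>p. sqrt (Re (?S p)) *\<^sub>R Q p))\<^sup>2
      \<le> norm_P P Q * norm_P P F + Re (boundary_term Q) / 2"
  proof -
    have "(norm_P P (\<lambda>p. sqrt (Re (?S p)) *\<^sub>R Q p))\<^sup>2 = ?I (\<lambda>p. Re (?S p) * ?e p) / 2"
    proof -
      have "?I (\<lambda>p. (sqrt (Re (?S p)) *\<^sub>R Q p) \<bullet> (?M p *v (sqrt (Re (?S p)) *\<^sub>R Q p)))
          = ?I (\<lambda>p. Re (?S p) * ?e p)"
      proof (rule set_lebesgue_integral_cong[OF Omega_sets], intro allI impI)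
        fix p assume "p \<in> Omega"
        then have "Re (?S p) \<ge> 0" using Re_S[of p] \<open>a > 0\<close> by simp
        then have "sqrt (Re (?S p)) * (sqrt (Re (?S p)) * x) = Re (?S p) * x" for x
          by (simp only: mult.assoc[symmetric] real_sqrt_mult_self abs_of_nonneg)
        then show "(sqrt (Re (?S p)) *\<^sub>R Q p) \<bullet> (?M p *v (sqrt (Re (?S p)) *\<^sub>R Q p)) = Re (?S p) * ?e p"
          by (simp only: linear_scale[OF linear_cmat] inner_scaleR_left inner_scaleR_right)
      qed
      then show ?thesis
        using norm_P_square(1)[of P "\<lambda>p. sqrt (Re (?S p)) *\<^sub>R Q p"] spd by (simp only:)
    qed
    moreover have "?I ?r \<le> 2 * (norm_P P Q * norm_P P F)"
    proof (rule norm_P_Cauchy_Schwarz[OF spd e r])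
      have "set_integrable lebesgue Omega (\<lambda>p. Re (hdot (F p) (?M p *v F p)))"
        using absolutely_integrable_linear[OF sources(3)[unfolded finite_norm_P_def] bounded_linear_Re]
        by (simp only: o_def)
      then show "(\<lambda>p. F p \<bullet> (?M p *v F p)) absolutely_integrable_on Omega"
        by (simp only: Re_hdot)
    qed
    ultimately show ?thesis using balance Re_BT by (simp add: add_divide_distrib)
  qed
  ultimately show ?thesis using Re_S by blast
qed

end
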